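(* Let $G$ be an arbitrary (not necessarily abelian) group, written multiplicatively with identity $e$, and let $F$ be a downward directed family of subsets of $G$ which is self-indulgent and closed under conjugation by all elements of $G$. Then the finest group topology on $G$ under which $F$ converges to $e$ is Hausdorff if and only if $$\bigcup_{n>0}\ \bigcap_{S\in F} (S^* )^n\ =\ \{e\},$$ in other words, if and only if for every $g\in G\setminus\{e\}$ and every integer $n>0$ there exists $S\in F$ with $g\notin (S^* )^n$. In particular, the hypotheses on $F$ hold if for some infinite conjugation-invariant subset $X\subseteq G$ and some regular infinite cardinal $\kappa\le\mathrm{card}(X)$, $F$ is the co-$\kappa$ filter on $X$.
   Context: A family $F$ of subsets of $G$ is downward directed if it is nonempty and for all $S_1,S_2\in F$ there is $S_3\in F$ with $S_3\subseteq S_1\cap S_2$. Such families are ordered by inclusion. A subset $F'\subseteq F$ is downward cofinal in $F$ if every member of $F$ contains a member of $F'$. $F$ is closed under conjugation if $gSg^{-1}\in F$ for all $S\in F$, $g\in G$. A group topology on $G$ is a (not necessarily Hausdorff) topology under which multiplication and inversion are continuous. $F$ converges to $x\in G$ under a topology $\mathcal{T}$ if every $\mathcal{T}$-neighborhood of $x$ contains a member of $F$. For every downward directed family $F$ there exists a finest group topology on $G$ under which $F$ converges to $e$. For $S\subseteq G$, $S^*=S\cup\{e\}\cup S^{-1}$, and $(S^* )^n$ is the $n$-fold product set $S^*\cdots S^*$. Strong convergence: if $(x_i)_{i\in I}$ is a family of elements of $G$ indexed by a downward directed partially ordered set $I$, then $(x_i)_{i\in I}$ converges strongly to $x\in G$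 with respect to $F$ if for every $S\in F$ there exists $i\in I$ such that for all $j\le i$ in $I$, $x_j\,x^{-1}\in S^*$. Self-indulgent: a downward directed family $F$ of subsets of $G$ is self-indulgent if for every $S\in F$ and every family $(x_T)_{T\in F'}$ of elements of $S^*$ indexed by a downward cofinal subset $F'\subseteq F$, there exist $x\in S^*$ and a downward cofinal subset $F''\subseteq F'$ such that $(x_T)_{T\in F''}$ (indexed by $F''$ ordered by inclusion) converges strongly to $x$ with respect to $F$. For an infinite set $X$ and an infinite cardinal $\kappa\le\mathrm{card}(X)$, the co-$\kappa$ filter on $X$ is the set of complements in $X$ of subsets of $X$ of cardinality $<\kappa$. *)

theory Defs
  imports "HOL-Analysis.Analysis" "HOL-Algebra.Coset"
begin

unbundle cardinal_syntax

definition downward_directed :: "('a, 'm) monoid_scheme \<Rightarrow> 'a set set \<Rightarrow> bool" where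
  "downward_directed G F \<longleftrightarrow>
     F \<subseteq> Pow (carrier G) \<and> F \<noteq> {} \<and>
     (\<forall>S1\<in>F. \<forall>S2\<in>F. \<exists>S3\<in>F. S3 \<subseteq> S1 \<inter> S2)"

definition downward_cofinal :: "'a set set \<Rightarrow> 'a set set \<Rightarrow> bool" where
  "downward_cofinal F' F \<longleftrightarrow> F' \<subseteq> F \<and> (\<forall>S\<in>F. \<exists>T\<in>F'. T \<subseteq> S)"

definition conjugate_set :: "('a, 'm) monoid_scheme \<Rightarrow> 'a \<Rightarrow> 'a set \<Rightarrow> 'a set" where
  "conjugate_set G g S = (g <#\<^bsub>G\<^esub> S) #>\<^bsub>G\<^esub> (inv\<^bsub>G\<^esub> g)"

definition conjugation_closed :: "('a, 'm) monoid_scheme \<Rightarrow> 'a set set \<Rightarrow> bool" where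
  "conjugation_closed G F \<longleftrightarrow> (\<forall>S\<in>F. \<forall>g\<in>carrier G. conjugate_set G g S \<in> F)"

definition star :: "('a, 'm) monoid_scheme \<Rightarrow> 'a set \<Rightarrow> 'a set" where
  "star G S = S \<union> {\<one>\<^bsub>G\<^esub>} \<union> set_inv\<^bsub>G\<^esub> S"

primrec set_power :: "('a, 'm) monoid_scheme \<Rightarrow> 'a set \<Rightarrow> nat \<Rightarrow> 'a set" where
  "set_power G A 0 = {\<one>\<^bsub>G\<^esub>}"
| "set_power G A (Suc n) = set_power G A n <#>\<^bsub>G\<^esub> A"

(* The index set I is a set in a type of class order. It is only ever instantiated with
   families of subsets of G, where the order of the class is inclusion. *)
definition strongly_converges ::
  "('a, 'm) monoid_scheme \<Rightarrow> 'a set set \<Rightarrow> 'i::order set \<Rightarrow> ('i \<Rightarrow> 'a) \<Rightarrow> 'a \<Rightarrow> bool" where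
  "strongly_converges G F I x a \<longleftrightarrow>
     (\<forall>S\<in>F. \<exists>i\<in>I. \<forall>j\<in>I. j \<le> i \<longrightarrow> x j \<otimes>\<^bsub>G\<^esub> inv\<^bsub>G\<^esub> a \<in> star G S)"

definition self_indulgent :: "('a, 'm) monoid_scheme \<Rightarrow> 'a set set \<Rightarrow> bool" where
  "self_indulgent G F \<longleftrightarrow>
     (\<forall>S\<in>F. \<forall>F' (x :: 'a set \<Rightarrow> 'a).
        downward_cofinal F' F \<and> (\<forall>T\<in>F'. x T \<in> star G S) \<longrightarrow>
        (\<exists>a\<in>star G S. \<exists>F''. downward_cofinal F'' F' \<and> strongly_converges G F F'' x a))"

definition group_topology :: "('a, 'm) monoid_scheme \<Rightarrow> 'a topology \<Rightarrow> bool" where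
  "group_topology G T \<longleftrightarrow>
     topspace T = carrier G \<and>
     continuous_map (prod_topology T T) T (\<lambda>(x, y). x \<otimes>\<^bsub>G\<^esub> y) \<and>
     continuous_map T T (\<lambda>x. inv\<^bsub>G\<^esub> x)"

definition family_converges :: "'a topology \<Rightarrow> 'a set set \<Rightarrow> 'a \<Rightarrow> bool" where
  "family_converges T F x \<longleftrightarrow> (\<forall>U. openin T U \<and> x \<in> U \<longrightarrow> (\<exists>S\<in>F. S \<subseteq> U))"

definition is_finest_group_topology ::
  "('a, 'm) monoid_scheme \<Rightarrow> 'a set set \<Rightarrow> 'a topology \<Rightarrow> bool" where
  "is_finest_group_topology G F T \<longleftrightarrow>
     group_topology G T \<and> family_converges T F \<one>\<^bsub>G\<^esub> \<and>
     (\<forall>T'. group_topology G T' \<and> family_converges T' F \<one>\<^bsub>G\<^esub> \<longrightarrow>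
           (\<forall>U. openin T' U \<longrightarrow> openin T U))"

definition finest_group_topology ::
  "('a, 'm) monoid_scheme \<Rightarrow> 'a set set \<Rightarrow> 'a topology" where
  "finest_group_topology G F = (THE T. is_finest_group_topology G F T)"

definition co_filter :: "'a set \<Rightarrow> 'k rel \<Rightarrow> 'a set set" where
  "co_filter X \<kappa> = {X - A | A. A \<subseteq> X \<and> |A| <o \<kappa>}"


(* The definite description above is justified. *)

lemma ex1_finest_group_topology:
  assumes "group G" and F: "downward_directed G F"
  shows "\<exists>!T. is_finest_group_topology G F T"
proof -
  interpret group G by fact
  define good where "good T \<longleftrightarrow> group_topology G T \<and> family_converges T F \<one>\<^bsub>G\<^esub>" for T
  define B where "B = {U. \<exists>T. good T \<and> openin T U}"
  define M where "M = topology_generated_by B"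
  define I where "I = topology (\<lambda>U. U = {} \<or> U = carrier G)"
  have opI: "openin I U \<longleftrightarrow> U = {} \<or> U = carrier G" for U
  proof -
    have "istopology (\<lambda>U. U = {} \<or> U = carrier G)"
      unfolding istopology_def by blast
    then show ?thesis by (simp add: I_def topology_inverse')
  qed
  have topI: "topspace I = carrier G"
    unfolding topspace_def by (auto simp: opI)
  have contI: "continuous_map Y I f" if "f \<in> topspace Y \<rightarrow> carrier G" for Y :: "'c topology" and f
    unfolding continuous_map_def
  proof (intro conjI allI impI)
    show "f \<in> topspace Y \<rightarrow> topspace I" using that by (simp add: topI)
    fix U assume "openin I U"
    then consider "U = {}" | "U = carrier G" by (auto simp: opI)
    then show "openin Y {x \<in> topspace Y. f x \<in> U}"
    proof cases
      case 2
      then have "{x \<in> topspace Y. f x \<in> U} = topspace Y" using that by auto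
      then show ?thesis by simp
    qed simp
  qed
  have gI: "good I"
    unfolding good_def group_topology_def
  proof (intro conjI topI contI)
    show "(\<lambda>(x, y). x \<otimes>\<^bsub>G\<^esub> y) \<in> topspace (prod_topology I I) \<rightarrow> carrier G"
      by (auto simp: topI)
    show "(\<lambda>x. inv\<^bsub>G\<^esub> x) \<in> topspace I \<rightarrow> carrier G" by (auto simp: topI)
    obtain S where "S \<in> F" "S \<subseteq> carrier G" using F unfolding downward_directed_def by blast
    then show "family_converges I F \<one>\<^bsub>G\<^esub>" unfolding family_converges_def opI by blast
  qed
  have topM: "topspace M = carrier G"
  proof -
    have "U \<subseteq> carrier G" if "U \<in> B" for U
      using that openin_subset by (fastforce simp: B_def good_def group_topology_def)
    moreover have "carrier G \<in> B" using gI opI by (auto simp: B_def)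
    ultimately show ?thesis unfolding M_def by auto
  qed
  have finer: "openin M U" if "good T" "openin T U" for T U
    unfolding M_def by (rule topology_generated_by_Basis) (use that in \<open>auto simp: B_def\<close>)
  have idc: "continuous_map M T (\<lambda>x. x)" if "good T" for T
  proof -
    have tT: "topspace T = carrier G" using that by (auto simp: good_def group_topology_def)
    show ?thesis
      unfolding continuous_map_def
    proof (intro conjI allI impI)
      show "(\<lambda>x. x) \<in> topspace M \<rightarrow> topspace T" by (simp add: topM tT)
      fix U assume U: "openin T U"
      then have "{x \<in> topspace M. x \<in> U} = U" using openin_subset[OF U] by (auto simp: topM tT)
      then show "openin M {x \<in> topspace M. x \<in> U}" using finer[OF that U] by simp
    qed
  qed
  have contM: "continuous_map Y M f"
    if c: "\<And>T. good T \<Longrightarrow> continuous_map Y T f" for Y :: "'c topology" and f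
    unfolding M_def
  proof (rule continuous_on_generated_topo)
    fix U assume "U \<in> B"
    then obtain T where T: "good T" "openin T U" by (auto simp: B_def)
    have "openin Y {x \<in> topspace Y. f x \<in> U}"
      using c[OF T(1)] T(2) by (auto simp: continuous_map_def)
    then show "openin Y (f -` U \<inter> topspace Y)"
      by (simp add: vimage_def Int_def conj_commute)
  next
    have "f ` topspace Y \<subseteq> carrier G"
      using c[OF gI] by (auto simp: continuous_map_def topI)
    then show "f ` topspace Y \<subseteq> \<Union> B" using topM unfolding M_def by simp
  qed
  have gM: "group_topology G M"
    unfolding group_topology_def
  proof (intro conjI topM contM)
    fix T assume T: "good T"
    have "continuous_map (prod_topology M M) (prod_topology T T) (\<lambda>(x, y). (x, y))"
      using continuous_map_prod_top[of M M T T "\<lambda>x. x" "\<lambda>x. x"] idc[OF T] by simp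
    moreover have "continuous_map (prod_topology T T) T (\<lambda>(x, y). x \<otimes>\<^bsub>G\<^esub> y)"
      using T by (auto simp: good_def group_topology_def)
    ultimately show "continuous_map (prod_topology M M) T (\<lambda>(x, y). x \<otimes>\<^bsub>G\<^esub> y)"
      using continuous_map_compose by (fastforce simp: o_def)
    have "continuous_map T T (\<lambda>x. inv\<^bsub>G\<^esub> x)"
      using T by (auto simp: good_def group_topology_def)
    then show "continuous_map M T (\<lambda>x. inv\<^bsub>G\<^esub> x)"
      using continuous_map_compose[OF idc[OF T]] by (fastforce simp: o_def)
  qed
  have "\<one>\<^bsub>G\<^esub> \<in> U \<longrightarrow> (\<exists>S\<in>F. S \<subseteq> U)" if "generate_topology_on B U" for U
    using that
  proof induction
    case (Int a b)
    show ?case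
    proof
      assume "\<one>\<^bsub>G\<^esub> \<in> a \<inter> b"
      then obtain S1 S2 where "S1 \<in> F" "S1 \<subseteq> a" "S2 \<in> F" "S2 \<subseteq> b" using Int by blast
      moreover from this obtain S3 where "S3 \<in> F" "S3 \<subseteq> S1 \<inter> S2"
        using F unfolding downward_directed_def by blast
      ultimately show "\<exists>S\<in>F. S \<subseteq> a \<inter> b" by blast
    qed
  next
    case (UN K)
    show ?case
    proof
      assume "\<one>\<^bsub>G\<^esub> \<in> \<Union>K"
      then obtain k where "k \<in> K" "\<one>\<^bsub>G\<^esub> \<in> k" by blast
      with UN.IH obtain S where "S \<in> F" "S \<subseteq> k" by blast
      with \<open>k \<in> K\<close> show "\<exists>S\<in>F. S \<subseteq> \<Union>K" by blast
    qed
  next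
    case (Basis s)
    then show ?case by (auto simp: B_def good_def family_converges_def)
  qed simp
  then have "family_converges M F \<one>\<^bsub>G\<^esub>"
    unfolding family_converges_def M_def openin_topology_generated_by_iff by blast
  then have "is_finest_group_topology G F M"
    using gM finer unfolding is_finest_group_topology_def good_def by blast
  moreover have "T = T'"
    if "is_finest_group_topology G F T" "is_finest_group_topology G F T'" for T T'
    using that unfolding is_finest_group_topology_def topology_eq by blast
  ultimately show ?thesis by blast
qed

end

theory Submission
  imports Defs
begin

text \<open>Suppose first that the topology is Hausdorff. In a group topology, every neighbourhood of the
  identity contains, for each \<open>n\<close>, a power \<open>V\<^sup>n\<close> of some neighbourhood \<open>V = V\<inverse>\<close>, and if \<open>F\<close>
  converges to the identity then \<open>V\<close> contains \<open>S\<^sup>*\<close> for some \<open>S \<in> F\<close>. So an element of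
  \<open>(S\<^sup>*)\<^sup>n\<close> for all \<open>S\<close> lies in every neighbourhood of the identity
  (\<open>separated_of_Hausdorff\<close>).

  For the other implication it is enough to exhibit one Hausdorff group topology in which \<open>F\<close>
  converges, since the finest one has even more open sets. For a sequence \<open>S\<close> in \<open>F\<close> let
  \<open>product_nbhd G S\<close> be the set of all finite products, in any order, of elements of sets
  \<open>(S i)\<^sup>*\<close> with pairwise distinct \<open>i\<close>. Because \<open>F\<close> is closed under conjugation, these sets form
  a neighbourhood base at the identity for a group topology (\<open>identity_base_product_base\<close>). It
  remains to find, for each \<open>g\<close> other than the identity, a sequence whose neighbourhood avoids
  \<open>g\<close>. The sequence is chosen term by term, preserving the condition that \<open>g\<close> is not a product
  over the indices treated so far.

  The step works by a compactness argument (\<open>avoid_extension\<close>). Suppose that for every choice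
  \<open>T \<in> F\<close> of the next term, \<open>g = a\<^sub>T t\<^sub>T b\<^sub>T\<close> with \<open>t\<^sub>T \<in> T\<^sup>*\<close> and with \<open>a\<^sub>T\<close>, \<open>b\<^sub>T\<close> products over
  disjoint sets of earlier indices. Self-indulgence gives every factor of \<open>a\<^sub>T\<close> and \<open>b\<^sub>T\<close> a strong
  limit along a cofinal subfamily, while \<open>t\<^sub>T\<close> tends to the identity. Moving the deviations past the
  limits by conjugation shows that \<open>g\<close> differs from the product \<open>a b\<close> of the limits by an element
  that lies in \<open>(S\<^sup>*)\<^sup>n\<close> for all \<open>S \<in> F\<close> and one fixed \<open>n\<close>. By hypothesis this element is the
  identity. So \<open>g = a b\<close> is a product over the earlier indices, contrary to the condition.

  For the complements of sets of size less than \<open>\<kappa>\<close>, a family of elements either takes one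
  value cofinally, which is then a limit of a subfamily, or avoids each
  single value from some member on. In the second case regularity of \<open>\<kappa>\<close> lets it avoid any fewer than \<open>\<kappa>\<close> values at once, so that
  it converges strongly to the identity.\<close>

section \<open>Product sets\<close>

context group
begin

lemma star_carrier: "A \<subseteq> carrier G \<Longrightarrow> star G A \<subseteq> carrier G"
  by (auto simp: star_def SET_INV_def)

lemma subset_star: "A \<subseteq> star G A"
  by (auto simp: star_def)

lemma one_in_star: "\<one> \<in> star G A"
  by (auto simp: star_def)

lemma star_mono: "A \<subseteq> B \<Longrightarrow> star G A \<subseteq> star G B"
  by (auto simp: star_def SET_INV_def)

lemma inv_in_star: "A \<subseteq> carrier G \<Longrightarrow> x \<in> star G A \<Longrightarrow> inv x \<in> star G A"
  by (auto simp: star_def SET_INV_def)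

lemma hom_star:
  assumes h: "h \<in> hom G G" and A: "A \<subseteq> carrier G" and hA: "h ` A \<subseteq> B" and x: "x \<in> star G A"
  shows "h x \<in> star G B"
proof -
  interpret group_hom G G h by unfold_locales (rule h)
  consider "x \<in> A" | "x = \<one>" | y where "y \<in> A" "x = inv y"
    using x by (auto simp: star_def SET_INV_def)
  then show ?thesis
  proof cases
    case 1
    then show ?thesis using hA by (auto simp: star_def)
  next
    case 2
    then show ?thesis by (simp add: star_def)
  next
    case 3
    then have "h x = inv (h y)" using A by (auto simp: subset_iff)
    moreover have "h y \<in> B" using 3 hA by auto
    ultimately show ?thesis by (auto simp: star_def SET_INV_def)
  qed
qed

lemma cancel_inv:
  assumes "x \<in> carrier G" "y \<in> carrier G"
  shows "x \<otimes> (inv x \<otimes> y) = y" "inv x \<otimes> (x \<otimes> y) = y"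
  using assms by (simp_all flip: m_assoc)

lemma conj_hom: "g \<in> carrier G \<Longrightarrow> (\<lambda>x. g \<otimes> x \<otimes> inv g) \<in> hom G G"
  by (rule homI) (simp_all add: m_assoc cancel_inv)

lemma conjugate_set_eq:
  "conjugate_set G g A = (\<lambda>x. g \<otimes> x \<otimes> inv g) ` A"
  by (auto simp: conjugate_set_def l_coset_def r_coset_def)

lemma id_hom: "(\<lambda>x. x) \<in> hom G G"
  by (simp add: hom_def)

lemma conj_image_conjugate_inv:
  assumes S: "S \<subseteq> carrier G" and g: "g \<in> carrier G"
  shows "(\<lambda>x. g \<otimes> x \<otimes> inv g) ` conjugate_set G (inv g) S \<subseteq> S"
  using S g by (auto simp: conjugate_set_eq m_assoc cancel_inv subset_iff)

lemma set_power_carrier: "A \<subseteq> carrier G \<Longrightarrow> set_power G A n \<subseteq> carrier G"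
  by (induction n) (auto simp: set_mult_def)

lemma set_power_mono: "A \<subseteq> B \<Longrightarrow> set_power G A n \<subseteq> set_power G B n"
  by (induction n) (auto simp: set_mult_def)

lemma set_power_add:
  assumes A: "A \<subseteq> carrier G" and x: "x \<in> set_power G A m" and y: "y \<in> set_power G A n"
  shows "x \<otimes> y \<in> set_power G A (m + n)"
  using y
proof (induction n arbitrary: y)
  case 0
  then show ?case using x set_power_carrier[OF A, of m] by (auto simp: subset_iff)
next
  case (Suc n)
  then obtain u a where y: "y = u \<otimes> a" "u \<in> set_power G A n" "a \<in> A"
    by (auto simp: set_mult_def)
  then have "x \<otimes> y = (x \<otimes> u) \<otimes> a"
    using x set_power_carrier[OF A] A by (simp add: m_assoc subset_iff)
  then show ?case using Suc.IH[OF y(2)] y(3) by (auto simp: set_mult_def)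
qed

lemma one_in_set_power: "\<one> \<in> A \<Longrightarrow> \<one> \<in> set_power G A n"
  by (induction n) (auto simp: set_mult_def intro!: bexI[of _ \<one>])

lemma hom_set_power:
  assumes h: "h \<in> hom G G" and A: "A \<subseteq> carrier G" and hA: "h ` A \<subseteq> B"
    and x: "x \<in> set_power G A n"
  shows "h x \<in> set_power G B n"
proof -
  interpret group_hom G G h by unfold_locales (rule h)
  show ?thesis using x
  proof (induction n arbitrary: x)
    case (Suc n)
    then obtain u a where x: "x = u \<otimes> a" "u \<in> set_power G A n" "a \<in> A"
      by (auto simp: set_mult_def)
    then have "h x = h u \<otimes> h a"
      using A set_power_carrier[OF A] by (auto simp: subset_iff)
    then show ?case using Suc.IH[OF x(2)] x(3) hA by (auto simp: set_mult_def)
  qed simp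
qed

end

text \<open>Products in which each index contributes at most one factor, taken in any order, from
  \<open>(S i)\<^sup>*\<close>. Leaving the order free is what makes the resulting sets compatible with inversion
  and with multiplication.\<close>

inductive product_over :: "('a, 'm) monoid_scheme \<Rightarrow> ('i \<Rightarrow> 'a set) \<Rightarrow> 'i set \<Rightarrow> 'a \<Rightarrow> bool"
  for G S where
  empty: "product_over G S {} \<one>\<^bsub>G\<^esub>"
| insert: "product_over G S I h \<Longrightarrow> i \<notin> I \<Longrightarrow> x \<in> star G (S i) \<Longrightarrow>
    product_over G S (insert i I) (x \<otimes>\<^bsub>G\<^esub> h)"

lemma product_over_finite: "product_over G S I h \<Longrightarrow> finite I"
  by (induction rule: product_over.induct) auto

lemma product_over_cong:
  assumes "product_over G S I h" "\<And>i. i \<in> I \<Longrightarrow> S i = S' i"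
  shows "product_over G S' I h"
  using assms
proof (induction rule: product_over.induct)
  case (insert I h i x)
  then have "x \<in> star G (S' i)" by auto
  then show ?case using insert by (auto intro!: product_over.insert)
qed (rule product_over.empty)

context group
begin

context
  fixes S :: "'i \<Rightarrow> 'a set"
  assumes S: "\<And>i. S i \<subseteq> carrier G"
begin

lemma product_over_carrier: "product_over G S I h \<Longrightarrow> h \<in> carrier G"
  by (induction rule: product_over.induct) (use star_carrier[OF S] in auto)

lemma product_over_singleton: "x \<in> star G (S i) \<Longrightarrow> product_over G S {i} x"
  using product_over.insert[OF product_over.empty, of i x G S] star_carrier[OF S, of i]
  by (auto simp: subset_iff)

lemma product_over_append:
  assumes "product_over G S I a" "product_over G S J b" "I \<inter> J = {}"
  shows "product_over G S (I \<union> J) (a \<otimes> b)"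
  using assms
proof (induction rule: product_over.induct)
  case empty
  then show ?case using product_over_carrier by simp
next
  case (insert I h i x)
  have "product_over G S (insert i (I \<union> J)) (x \<otimes> (h \<otimes> b))"
    by (rule product_over.insert) (use insert in auto)
  moreover have "x \<in> carrier G" "h \<in> carrier G" "b \<in> carrier G"
    using star_carrier[OF S] insert product_over_carrier by auto
  ultimately show ?case by (simp add: m_assoc)
qed

lemma product_over_one: "finite I \<Longrightarrow> product_over G S I \<one>"
proof (induction rule: finite_induct)
  case (insert i I)
  then show ?case using product_over.insert[of G S I \<one> i \<one>] one_in_star by simp
qed (rule product_over.empty)

lemma product_over_mono:
  assumes "product_over G S I h" "I \<subseteq> J" "finite J"
  shows "product_over G S J h"
proof -
  have "product_over G S (I \<union> (J - I)) (h \<otimes> \<one>)"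
    by (rule product_over_append) (use assms product_over_one in auto)
  moreover have "I \<union> (J - I) = J" using assms by auto
  ultimately show ?thesis using product_over_carrier[OF assms(1)] by simp
qed

lemma product_over_inv: "product_over G S I h \<Longrightarrow> product_over G S I (inv h)"
proof (induction rule: product_over.induct)
  case empty
  then show ?case by (simp add: product_over.empty)
next
  case (insert I h i x)
  have "product_over G S (I \<union> {i}) (inv h \<otimes> inv x)"
    by (rule product_over_append)
      (use insert product_over_singleton inv_in_star[OF S] in auto)
  moreover have "x \<in> carrier G" "h \<in> carrier G"
    using star_carrier[OF S] insert product_over_carrier by auto
  ultimately show ?case by (simp add: inv_mult_group)
qed

text \<open>Isolating the factor with index \<open>i\<close>: what stands to its left and to its right are products
  over disjoint sets of the other indices.\<close>

lemma product_over_split: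
  assumes "product_over G S I h" "i \<in> I"
  shows "\<exists>J K a t b. J \<subseteq> I - {i} \<and> K \<subseteq> I - {i} \<and> J \<inter> K = {} \<and> product_over G S J a \<and>
     t \<in> star G (S i) \<and> product_over G S K b \<and> h = a \<otimes> t \<otimes> b"
  using assms
proof (induction rule: product_over.induct)
  case (insert I h j x)
  have x: "x \<in> carrier G" and h: "h \<in> carrier G"
    using star_carrier[OF S, of j] insert.hyps product_over_carrier by auto
  show ?case
  proof (cases "i = j")
    case True
    then have "{} \<subseteq> insert j I - {i}" "I \<subseteq> insert j I - {i}" "{} \<inter> I = {}" "x \<in> star G (S i)"
        "x \<otimes> h = \<one> \<otimes> x \<otimes> h"
      using insert x by auto
    then show ?thesis
      using insert.hyps(1) product_over.empty[of G S]
      by - (rule exI[of _ "{}"], rule exI[of _ I], rule exI[of _ \<one>], rule exI[of _ x],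
          rule exI[of _ h], simp)
  next
    case False
    with insert obtain J K a t b where *: "J \<subseteq> I - {i}" "K \<subseteq> I - {i}" "J \<inter> K = {}"
      "product_over G S J a" "t \<in> star G (S i)" "product_over G S K b" "h = a \<otimes> t \<otimes> b"
      by blast
    have "product_over G S (insert j J) (x \<otimes> a)"
      by (rule product_over.insert) (use * insert in auto)
    moreover have "x \<otimes> h = (x \<otimes> a) \<otimes> t \<otimes> b"
      using x product_over_carrier[OF *(4)] product_over_carrier[OF *(6)]
        subsetD[OF star_carrier[OF S] *(5)] *(7) by (simp add: m_assoc)
    moreover have "insert j J \<subseteq> insert j I - {i}" "K \<subseteq> insert j I - {i}" "insert j J \<inter> K = {}"
      using * False insert by auto
    ultimately show ?thesis
      using *(5,6)
      by - (rule exI[of _ "insert j J"], rule exI[of _ K], rule exI[of _ "x \<otimes> a"],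
          rule exI[of _ t], rule exI[of _ b], intro conjI)
  qed
qed auto

text \<open>Peeling off the leftmost factor presents the products over a finite index set as a finite
  union of two-fold product sets, the form in which compactness passes to them by induction.\<close>

lemma product_over_Diff_eq:
  assumes ne: "I \<noteq> {}"
  shows "{h. product_over G S I h} = (\<Union>i\<in>I. star G (S i) <#> {h. product_over G S (I - {i}) h})"
    (is "?L = ?R")
proof
  show "?L \<subseteq> ?R"
  proof
    fix h assume "h \<in> ?L"
    then have "product_over G S I h" by simp
    then show "h \<in> ?R"
    proof cases
      case (insert J h' i x)
      then have "I - {i} = J" by auto
      then have "h \<in> star G (S i) <#> {h. product_over G S (I - {i}) h}"
        using insert unfolding set_mult_def by simp blast
      then show ?thesis using insert(1) by blast
    qed (use ne in simp)
  qed
  show "?R \<subseteq> ?L"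
  proof
    fix h assume "h \<in> ?R"
    then obtain i x h' where h: "i \<in> I" "x \<in> star G (S i)" "product_over G S (I - {i}) h'"
      "h = x \<otimes> h'"
      unfolding set_mult_def by auto
    have "product_over G S (insert i (I - {i})) (x \<otimes> h')"
      by (rule product_over.insert) (use h in auto)
    then show "h \<in> ?L" using h by (simp add: insert_absorb)
  qed
qed

text \<open>The one transport principle for these products. With the identity map it reindexes them or
  shrinks the sets; with an inner automorphism it conjugates them.\<close>

lemma product_over_hom:
  assumes h: "h \<in> hom G G" and inj: "inj_on \<phi> I" and sub: "\<And>i. i \<in> I \<Longrightarrow> h ` S i \<subseteq> S' (\<phi> i)"
    and p: "product_over G S I a"
  shows "product_over G S' (\<phi> ` I) (h a)"
proof -
  interpret group_hom G G h by unfold_locales (rule h)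
  show ?thesis using p inj sub
  proof (induction rule: product_over.induct)
    case empty
    then show ?case by (simp add: product_over.empty)
  next
    case (insert I a i x)
    have "product_over G S' (insert (\<phi> i) (\<phi> ` I)) (h x \<otimes> h a)"
      by (rule product_over.insert)
        (use insert hom_star[OF h S, of i "S' (\<phi> i)" x] in auto)
    moreover have "x \<in> carrier G" "a \<in> carrier G"
      using star_carrier[OF S] insert product_over_carrier by auto
    ultimately show ?case by simp
  qed
qed

end

end

section \<open>Group topologies from a base at the identity\<close>

definition base_topology :: "('a, 'm) monoid_scheme \<Rightarrow> 'a set set \<Rightarrow> 'a topology" where
  "base_topology G B =
     topology (\<lambda>V. V \<subseteq> carrier G \<and> (\<forall>x\<in>V. \<exists>U\<in>B. \<forall>u\<in>U. x \<otimes>\<^bsub>G\<^esub> u \<in> V))"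

text \<open>The axiom \<open>base_open\<close> makes the base sets open themselves, and hence their left
  translates: these serve directly as open neighbourhoods of arbitrary points.\<close>

locale identity_base = group +
  fixes B
  assumes base_ne: "B \<noteq> {}"
    and base_carrier: "U \<in> B \<Longrightarrow> U \<subseteq> carrier G"
    and base_one: "U \<in> B \<Longrightarrow> \<one> \<in> U"
    and base_inter: "U \<in> B \<Longrightarrow> V \<in> B \<Longrightarrow> \<exists>W\<in>B. W \<subseteq> U \<inter> V"
    and base_open: "U \<in> B \<Longrightarrow> z \<in> U \<Longrightarrow> \<exists>V\<in>B. \<forall>v\<in>V. z \<otimes> v \<in> U"
    and base_mult: "U \<in> B \<Longrightarrow> \<exists>V\<in>B. \<forall>x\<in>V. \<forall>y\<in>V. x \<otimes> y \<in> U"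
    and base_inv: "U \<in> B \<Longrightarrow> \<exists>V\<in>B. \<forall>x\<in>V. inv x \<in> U"
    and base_conj: "U \<in> B \<Longrightarrow> g \<in> carrier G \<Longrightarrow> \<exists>V\<in>B. \<forall>v\<in>V. g \<otimes> v \<otimes> inv g \<in> U"
begin

lemma openin_base_topology:
  "openin (base_topology G B) V \<longleftrightarrow> V \<subseteq> carrier G \<and> (\<forall>x\<in>V. \<exists>U\<in>B. \<forall>u\<in>U. x \<otimes> u \<in> V)"
proof -
  have "istopology (\<lambda>V. V \<subseteq> carrier G \<and> (\<forall>x\<in>V. \<exists>U\<in>B. \<forall>u\<in>U. x \<otimes> u \<in> V))"
    unfolding istopology_def
  proof (intro conjI allI impI ballI)
    fix V W x
    assume V: "V \<subseteq> carrier G \<and> (\<forall>x\<in>V. \<exists>U\<in>B. \<forall>u\<in>U. x \<otimes> u \<in> V)"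
      and W: "W \<subseteq> carrier G \<and> (\<forall>x\<in>W. \<exists>U\<in>B. \<forall>u\<in>U. x \<otimes> u \<in> W)" and x: "x \<in> V \<inter> W"
    obtain U1 U2 where U: "U1 \<in> B" "\<forall>u\<in>U1. x \<otimes> u \<in> V" "U2 \<in> B" "\<forall>u\<in>U2. x \<otimes> u \<in> W"
      using V W x by blast
    then obtain U where "U \<in> B" "U \<subseteq> U1 \<inter> U2" using base_inter by blast
    with U show "\<exists>U\<in>B. \<forall>u\<in>U. x \<otimes> u \<in> V \<inter> W" by blast
  next
    fix \<V> x
    assume "\<forall>V\<in>\<V>. V \<subseteq> carrier G \<and> (\<forall>x\<in>V. \<exists>U\<in>B. \<forall>u\<in>U. x \<otimes> u \<in> V)" and "x \<in> \<Union>\<V>"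
    then show "\<exists>U\<in>B. \<forall>u\<in>U. x \<otimes> u \<in> \<Union>\<V>" by (meson Union_iff)
  qed auto
  then show ?thesis by (simp add: base_topology_def)
qed

lemma topspace_base_topology: "topspace (base_topology G B) = carrier G"
proof
  have "openin (base_topology G B) (carrier G)"
    unfolding openin_base_topology using base_ne base_carrier by (meson ex_in_conv m_closed order_refl subsetD)
  then show "carrier G \<subseteq> topspace (base_topology G B)" by (rule openin_subset)
  show "topspace (base_topology G B) \<subseteq> carrier G"
    using openin_topspace openin_base_topology by blast
qed

lemma open_translate:
  assumes x: "x \<in> carrier G" and U: "U \<in> B"
  shows "openin (base_topology G B) ((\<lambda>u. x \<otimes> u) ` U)"
  unfolding openin_base_topology
proof (intro conjI ballI)
  show "(\<lambda>u. x \<otimes> u) ` U \<subseteq> carrier G" using x base_carrier[OF U] by auto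
  fix y assume "y \<in> (\<lambda>u. x \<otimes> u) ` U"
  then obtain z where z: "z \<in> U" "y = x \<otimes> z" by blast
  obtain V where V: "V \<in> B" "\<forall>v\<in>V. z \<otimes> v \<in> U" using base_open[OF U z(1)] by blast
  have "y \<otimes> v = x \<otimes> (z \<otimes> v)" if "v \<in> V" for v
    using x z base_carrier[OF U] base_carrier[OF V(1)] that by (auto simp: m_assoc subset_iff)
  then show "\<exists>V\<in>B. \<forall>v\<in>V. y \<otimes> v \<in> (\<lambda>u. x \<otimes> u) ` U" using V by blast
qed

lemma in_translate: "x \<in> carrier G \<Longrightarrow> U \<in> B \<Longrightarrow> x \<in> (\<lambda>u. x \<otimes> u) ` U"
  using base_one by force

lemma group_topology_base_topology: "group_topology G (base_topology G B)"
  unfolding group_topology_def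
proof (intro conjI topspace_base_topology)
  let ?T = "base_topology G B"
  show "continuous_map (prod_topology ?T ?T) ?T (\<lambda>(x, y). x \<otimes> y)"
    unfolding continuous_map_def openin_prod_topology_alt
  proof (intro conjI allI impI)
    fix W x y
    assume W: "openin ?T W"
      and xy: "(x, y) \<in> {p \<in> topspace (prod_topology ?T ?T). (case p of (x, y) \<Rightarrow> x \<otimes> y) \<in> W}"
    then have c: "x \<in> carrier G" "y \<in> carrier G" "x \<otimes> y \<in> W"
      by (auto simp: topspace_base_topology)
    obtain U where U: "U \<in> B" "\<forall>u\<in>U. (x \<otimes> y) \<otimes> u \<in> W"
      using W c unfolding openin_base_topology by blast
    obtain V where V: "V \<in> B" "\<forall>a\<in>V. \<forall>b\<in>V. a \<otimes> b \<in> U" using base_mult[OF U(1)] by blast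
    obtain V' where V': "V' \<in> B" "\<forall>v\<in>V'. inv y \<otimes> v \<otimes> y \<in> V"
      using base_conj[OF V(1), of "inv y"] c by auto
    \<comment> \<open>Conjugating by \<open>y\<close> brings both deviations \<open>a\<close> and \<open>b\<close> to the right of \<open>x \<otimes> y\<close>.\<close>
    have "x \<otimes> a \<otimes> (y \<otimes> b) \<in> W" if ab: "a \<in> V'" "b \<in> V" for a b
    proof -
      have [simp]: "a \<in> carrier G" "b \<in> carrier G" using ab base_carrier V V' by auto
      have "x \<otimes> a \<otimes> (y \<otimes> b) = (x \<otimes> y) \<otimes> ((inv y \<otimes> a \<otimes> y) \<otimes> b)"
        using c by (simp add: m_assoc cancel_inv)
      then show ?thesis using U V V' ab by simp
    qed
    then have "(\<lambda>u. x \<otimes> u) ` V' \<times> (\<lambda>u. y \<otimes> u) ` V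
        \<subseteq> {p \<in> topspace (prod_topology ?T ?T). (case p of (x, y) \<Rightarrow> x \<otimes> y) \<in> W}"
      using c base_carrier[OF V(1)] base_carrier[OF V'(1)]
      by (auto simp: topspace_base_topology)
    then show "\<exists>P Q. openin ?T P \<and> openin ?T Q \<and> x \<in> P \<and> y \<in> Q \<and>
        P \<times> Q \<subseteq> {p \<in> topspace (prod_topology ?T ?T). (case p of (x, y) \<Rightarrow> x \<otimes> y) \<in> W}"
      by (intro exI[of _ "(\<lambda>u. x \<otimes> u) ` V'"] exI[of _ "(\<lambda>u. y \<otimes> u) ` V"] conjI
          open_translate in_translate c V(1) V'(1))
  qed (auto simp: topspace_base_topology)
  show "continuous_map ?T ?T (\<lambda>x. inv x)"
    unfolding continuous_map_def
  proof (intro conjI allI impI)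
    fix W assume W: "openin ?T W"
    show "openin ?T {x \<in> topspace ?T. inv x \<in> W}"
      unfolding openin_base_topology
    proof (intro conjI ballI)
      fix x assume "x \<in> {x \<in> topspace ?T. inv x \<in> W}"
      then have x: "x \<in> carrier G" "inv x \<in> W" by (auto simp: topspace_base_topology)
      then obtain U where U: "U \<in> B" "\<forall>u\<in>U. inv x \<otimes> u \<in> W"
        using W unfolding openin_base_topology by blast
      obtain V where V: "V \<in> B" "\<forall>a\<in>V. inv a \<in> U" using base_inv[OF U(1)] by blast
      obtain V' where V': "V' \<in> B" "\<forall>v\<in>V'. x \<otimes> v \<otimes> inv x \<in> V"
        using base_conj[OF V(1) x(1)] by blast
      have "inv (x \<otimes> v) \<in> W" if v: "v \<in> V'" for v
      proof -
        have [simp]: "v \<in> carrier G" using v base_carrier V' by auto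
        have "inv (x \<otimes> v) = inv x \<otimes> inv (x \<otimes> v \<otimes> inv x)"
          using x by (simp add: inv_mult_group m_assoc cancel_inv)
        then show ?thesis using U V V' v by simp
      qed
      then show "\<exists>V\<in>B. \<forall>v\<in>V. x \<otimes> v \<in> {x \<in> topspace ?T. inv x \<in> W}"
        unfolding topspace_base_topology
        using x(1) base_carrier[OF V'(1)] by (intro bexI[OF _ V'(1)] ballI CollectI conjI) auto
    qed (auto simp: topspace_base_topology)
  qed (auto simp: topspace_base_topology)
qed

lemma Hausdorff_base_topology:
  assumes sep: "\<And>g. g \<in> carrier G \<Longrightarrow> g \<noteq> \<one> \<Longrightarrow> \<exists>U\<in>B. g \<notin> U"
  shows "Hausdorff_space (base_topology G B)"
  unfolding Hausdorff_space_def
proof (intro allI impI)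
  fix x y
  assume "x \<in> topspace (base_topology G B) \<and> y \<in> topspace (base_topology G B) \<and> x \<noteq> y"
  then have xy: "x \<in> carrier G" "y \<in> carrier G" "x \<noteq> y" by (auto simp: topspace_base_topology)
  then have "inv x \<otimes> y \<noteq> \<one>" using cancel_inv(1)[of x y] by force
  then obtain U where U: "U \<in> B" "inv x \<otimes> y \<notin> U" using sep xy by blast
  obtain V where V: "V \<in> B" "\<forall>a\<in>V. \<forall>b\<in>V. a \<otimes> b \<in> U" using base_mult[OF U(1)] by blast
  obtain V' where V': "V' \<in> B" "\<forall>a\<in>V'. inv a \<in> V" using base_inv[OF V(1)] by blast
  have "x \<otimes> a \<noteq> y \<otimes> b" if ab: "a \<in> V" "b \<in> V'" for a b
  proof
    assume eq: "x \<otimes> a = y \<otimes> b"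
    have c: "a \<in> carrier G" "b \<in> carrier G" using ab base_carrier V V' by auto
    have "inv x \<otimes> y = inv x \<otimes> (y \<otimes> b) \<otimes> inv b" using xy c by (simp add: m_assoc)
    also have "\<dots> = a \<otimes> inv b" using xy c by (simp flip: eq add: m_assoc cancel_inv)
    finally show False using U V V' ab by auto
  qed
  then have "disjnt ((\<lambda>u. x \<otimes> u) ` V) ((\<lambda>u. y \<otimes> u) ` V')" by (auto simp: disjnt_def)
  then show "\<exists>P Q. openin (base_topology G B) P \<and> openin (base_topology G B) Q \<and>
      x \<in> P \<and> y \<in> Q \<and> disjnt P Q"
    by (intro exI[of _ "(\<lambda>u. x \<otimes> u) ` V"] exI[of _ "(\<lambda>u. y \<otimes> u) ` V'"] conjI
        open_translate in_translate xy V(1) V'(1))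
qed

end

section \<open>Neighbourhoods built from a conjugation-closed family\<close>

definition product_nbhd :: "('a, 'm) monoid_scheme \<Rightarrow> (nat \<Rightarrow> 'a set) \<Rightarrow> 'a set" where
  "product_nbhd G S = {h. \<exists>I. product_over G S I h}"

definition product_base :: "('a, 'm) monoid_scheme \<Rightarrow> 'a set set \<Rightarrow> 'a set set" where
  "product_base G F = {product_nbhd G S | S. range S \<subseteq> F}"

lemma product_baseI: "(\<And>i. S i \<in> F) \<Longrightarrow> product_nbhd G S \<in> product_base G F"
  unfolding product_base_def by blast

locale conjugation_closed_family = group +
  fixes F
  assumes directed: "downward_directed G F"
    and conj_closed: "conjugation_closed G F"
begin

lemma F_carrier: "S \<in> F \<Longrightarrow> S \<subseteq> carrier G"
  using directed by (auto simp: downward_directed_def)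

lemma F_ne: "F \<noteq> {}"
  using directed by (simp add: downward_directed_def)

lemma F_inter: "S \<in> F \<Longrightarrow> T \<in> F \<Longrightarrow> \<exists>R\<in>F. R \<subseteq> S \<inter> T"
  using directed by (simp add: downward_directed_def)

lemma F_conj: "S \<in> F \<Longrightarrow> g \<in> carrier G \<Longrightarrow> conjugate_set G g S \<in> F"
  using conj_closed by (simp add: conjugation_closed_def)

text \<open>Multiplication is handled by interleaving: two sequences placed at the even and at the odd
  indices never compete for an index. Closure of \<open>F\<close> under conjugation
  provides the conjugation axiom.\<close>

lemma identity_base_product_base: "identity_base G (product_base G F)"
proof unfold_locales
  show "product_base G F \<noteq> {}"
  proof -
    obtain S where "S \<in> F" using F_ne by blast
    then have "range (\<lambda>_::nat. S) \<subseteq> F" by auto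
    then show ?thesis unfolding product_base_def by blast
  qed
next
  fix U V assume "U \<in> product_base G F" "V \<in> product_base G F"
  then obtain S T where S: "U = product_nbhd G S" "range S \<subseteq> F"
    and T: "V = product_nbhd G T" "range T \<subseteq> F"
    unfolding product_base_def by blast
  have "\<exists>R. R \<in> F \<and> R \<subseteq> S i \<inter> T i" for i using F_inter[of "S i" "T i"] S(2) T(2) by blast
  then obtain R where R: "\<And>i. R i \<in> F" "\<And>i. R i \<subseteq> S i \<inter> T i" by metis
  have Rc: "R i \<subseteq> carrier G" for i using R(1) F_carrier by blast
  have "product_over G Q ((\<lambda>i. i) ` I) h"
    if "product_over G R I h" "\<And>i. R i \<subseteq> Q i" for Q I h
    by (rule product_over_hom[where S = R, OF Rc id_hom _ _ that(1)]) (use that(2) in auto)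
  then have "product_nbhd G R \<subseteq> product_nbhd G Q" if "\<And>i. R i \<subseteq> Q i" for Q
    unfolding product_nbhd_def using that by blast
  then have "product_nbhd G R \<subseteq> product_nbhd G S \<inter> product_nbhd G T"
    using R(2) by simp
  moreover have "product_nbhd G R \<in> product_base G F" using R(1) by (rule product_baseI)
  ultimately show "\<exists>W\<in>product_base G F. W \<subseteq> U \<inter> V" using S(1) T(1) by blast
next
  fix U assume "U \<in> product_base G F"
  then obtain S where U: "U = product_nbhd G S" and S: "range S \<subseteq> F"
    unfolding product_base_def by blast
  have Sc: "S i \<subseteq> carrier G" for i using S F_carrier by blast
  show "U \<subseteq> carrier G" using product_over_carrier[where S = S, OF Sc] by (auto simp: U product_nbhd_def)
  show "\<one> \<in> U" using product_over.empty[of G S] by (auto simp: U product_nbhd_def)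
  show "\<exists>V\<in>product_base G F. \<forall>v\<in>V. z \<otimes> v \<in> U" if z: "z \<in> U" for z
  proof -
    from z obtain I where I: "product_over G S I z" by (auto simp: U product_nbhd_def)
    obtain m where m: "\<forall>i\<in>I. i < m"
      using product_over_finite[OF I] unfolding finite_nat_set_iff_bounded ..
    \<comment> \<open>Shifting the sequence beyond the indices used by \<open>z\<close> keeps all indices distinct.\<close>
    define S' where "S' i = S (i + m)" for i
    have "z \<otimes> v \<in> U" if v: "v \<in> product_nbhd G S'" for v
    proof -
      obtain J where J: "product_over G S' J v" using v by (auto simp: product_nbhd_def)
      have S'c: "S' i \<subseteq> carrier G" for i by (simp add: S'_def Sc)
      have "product_over G S ((\<lambda>i. i + m) ` J) v"
        by (rule product_over_hom[where S = S', OF S'c id_hom _ _ J]) (auto simp: S'_def)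
      then have "product_over G S (I \<union> (\<lambda>i. i + m) ` J) (z \<otimes> v)"
        by (rule product_over_append[where S = S, OF Sc I]) (use m in auto)
      then show ?thesis by (auto simp: U product_nbhd_def)
    qed
    moreover have "product_nbhd G S' \<in> product_base G F"
      by (rule product_baseI) (use S in \<open>auto simp: S'_def\<close>)
    ultimately show ?thesis by blast
  qed
  show "\<exists>V\<in>product_base G F. \<forall>x\<in>V. \<forall>y\<in>V. x \<otimes> y \<in> U"
  proof -
    \<comment> \<open>The left factor is moved to the even indices and the right one to the odd indices.\<close>
    have "\<exists>R. R \<in> F \<and> R \<subseteq> S (2 * i) \<inter> S (2 * i + 1)" for i
      using F_inter[of "S (2 * i)" "S (2 * i + 1)"] S by blast
    then obtain R where R: "\<And>i. R i \<in> F" "\<And>i. R i \<subseteq> S (2 * i) \<inter> S (2 * i + 1)" by metis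
    have Rc: "R i \<subseteq> carrier G" for i using R(1) F_carrier by blast
    have "x \<otimes> y \<in> U" if xy: "x \<in> product_nbhd G R" "y \<in> product_nbhd G R" for x y
    proof -
      obtain I J where I: "product_over G R I x" and J: "product_over G R J y"
        using xy by (auto simp: product_nbhd_def)
      have "product_over G S ((\<lambda>i. 2 * i) ` I) x"
        by (rule product_over_hom[where S = R, OF Rc id_hom _ _ I]) (use R(2) in \<open>auto simp: inj_on_def\<close>)
      moreover have "product_over G S ((\<lambda>i. 2 * i + 1) ` J) y"
        by (rule product_over_hom[where S = R, OF Rc id_hom _ _ J]) (use R(2) in \<open>auto simp: inj_on_def\<close>)
      moreover have "(\<lambda>i. 2 * i) ` I \<inter> (\<lambda>i. 2 * i + 1) ` J = {}"
        by (auto, presburger)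
      ultimately have "product_over G S ((\<lambda>i. 2 * i) ` I \<union> (\<lambda>i. 2 * i + 1) ` J) (x \<otimes> y)"
        by (rule product_over_append[where S = S, OF Sc])
      then show ?thesis by (auto simp: U product_nbhd_def)
    qed
    moreover have "product_nbhd G R \<in> product_base G F"
      using R(1) by (rule product_baseI)
    ultimately show ?thesis by blast
  qed
  show "\<exists>V\<in>product_base G F. \<forall>x\<in>V. inv x \<in> U"
    using product_over_inv[where S = S, OF Sc] \<open>U \<in> product_base G F\<close>
    by (intro bexI[of _ U]) (auto simp: U product_nbhd_def)
  show "\<exists>V\<in>product_base G F. \<forall>v\<in>V. g \<otimes> v \<otimes> inv g \<in> U" if g: "g \<in> carrier G" for g
  proof -
    define S' where "S' i = conjugate_set G (inv g) (S i)" for i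
    have S': "range S' \<subseteq> F" using S F_conj g by (auto simp: S'_def)
    then have S'c: "S' i \<subseteq> carrier G" for i using F_carrier by blast
    have "g \<otimes> v \<otimes> inv g \<in> U" if v: "v \<in> product_nbhd G S'" for v
    proof -
      obtain I where I: "product_over G S' I v" using v by (auto simp: product_nbhd_def)
      have "product_over G S ((\<lambda>i. i) ` I) (g \<otimes> v \<otimes> inv g)"
        by (rule product_over_hom[where S = S', OF S'c conj_hom[OF g] _ _ I])
          (use conj_image_conjugate_inv[OF Sc g] in \<open>auto simp: S'_def\<close>)
      then show ?thesis by (auto simp: U product_nbhd_def)
    qed
    moreover have "product_nbhd G S' \<in> product_base G F" using S' by (intro product_baseI) auto
    ultimately show ?thesis by blast
  qed
qed

sublocale product_base: identity_base G "product_base G F"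
  by (rule identity_base_product_base)

lemma product_base_converges: "family_converges (base_topology G (product_base G F)) F \<one>"
  unfolding family_converges_def product_base.openin_base_topology
proof (intro allI impI, elim conjE)
  fix U assume "\<forall>x\<in>U. \<exists>V\<in>product_base G F. \<forall>u\<in>V. x \<otimes> u \<in> U" and "\<one> \<in> U"
  then obtain V where V: "V \<in> product_base G F" "\<forall>u\<in>V. \<one> \<otimes> u \<in> U" by blast
  obtain S where S: "range S \<subseteq> F" and VS: "V = product_nbhd G S"
    using V(1) unfolding product_base_def by blast
  have Sc: "S i \<subseteq> carrier G" for i using S F_carrier by blast
  have "S 0 \<subseteq> U"
  proof
    fix x assume x: "x \<in> S 0"
    then have "product_over G S {0} x"
      by (intro product_over_singleton[where S = S, OF Sc] subsetD[OF subset_star])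
    then have "\<one> \<otimes> x \<in> U" using V(2) by (auto simp: VS product_nbhd_def)
    then show "x \<in> U" using subsetD[OF Sc x] by simp
  qed
  then show "\<exists>S\<in>F. S \<subseteq> U" using S by blast
qed

lemma finest: "is_finest_group_topology G F (finest_group_topology G F)"
  unfolding finest_group_topology_def
  using ex1_finest_group_topology[OF group_axioms directed] by (rule theI')

text \<open>Passing to a finer topology preserves the Hausdorff property, so the topology given by the
  product neighbourhoods may stand in for the finest one.\<close>

lemma Hausdorff_finest:
  assumes "\<And>g. g \<in> carrier G \<Longrightarrow> g \<noteq> \<one> \<Longrightarrow> \<exists>S. range S \<subseteq> F \<and> g \<notin> product_nbhd G S"
  shows "Hausdorff_space (finest_group_topology G F)"
proof -
  let ?T = "base_topology G (product_base G F)"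
  have H: "Hausdorff_space ?T"
  proof (rule product_base.Hausdorff_base_topology)
    fix g assume "g \<in> carrier G" "g \<noteq> \<one>"
    then obtain S where S: "range S \<subseteq> F" "g \<notin> product_nbhd G S" using assms by blast
    then have "product_nbhd G S \<in> product_base G F" by (intro product_baseI) auto
    then show "\<exists>U\<in>product_base G F. g \<notin> U" using S(2) by blast
  qed
  have op: "openin (finest_group_topology G F) U" if "openin ?T U" for U
    using finest product_base.group_topology_base_topology product_base_converges that
    unfolding is_finest_group_topology_def by blast
  have "topspace (finest_group_topology G F) = topspace ?T"
    using finest product_base.topspace_base_topology
    by (auto simp: is_finest_group_topology_def group_topology_def)
  with H have sep: "\<exists>U V. openin ?T U \<and> openin ?T V \<and> x \<in> U \<and> y \<in> V \<and> disjnt U V"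
    if "x \<in> topspace (finest_group_topology G F)" "y \<in> topspace (finest_group_topology G F)"
      "x \<noteq> y" for x y
    using that unfolding Hausdorff_space_def by simp
  show ?thesis
    unfolding Hausdorff_space_def
  proof (intro allI impI, elim conjE)
    fix x y
    assume "x \<in> topspace (finest_group_topology G F)" "y \<in> topspace (finest_group_topology G F)"
      "x \<noteq> y"
    from sep[OF this] obtain U V
      where "openin ?T U" "openin ?T V" "x \<in> U" "y \<in> V" "disjnt U V" by blast
    with op show "\<exists>U V. openin (finest_group_topology G F) U \<and>
        openin (finest_group_topology G F) V \<and> x \<in> U \<and> y \<in> V \<and> disjnt U V"
      by (intro exI conjI)
  qed
qed

section \<open>Convergence up to products of bounded length\<close>

text \<open>Strong convergence weakened to deviations in a power \<open>(S\<^sup>*)\<^sup>n\<close>, with \<open>n\<close> independent of \<open>S\<close>.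
  Unlike strong convergence it survives products, where the exponents add up.\<close>

definition loosely_converges :: "'a set set \<Rightarrow> ('a set \<Rightarrow> 'a) \<Rightarrow> 'a \<Rightarrow> bool" where
  "loosely_converges I x a \<longleftrightarrow>
     (\<exists>n. \<forall>S\<in>F. \<exists>i\<in>I. \<forall>j\<in>I. j \<subseteq> i \<longrightarrow> x j \<otimes> inv a \<in> set_power G (star G S) n)"

text \<open>Sequential compactness, with cofinal subfamilies of \<open>F\<close> in the role of subsequences.\<close>

definition loosely_compact :: "'a set \<Rightarrow> bool" where
  "loosely_compact K \<longleftrightarrow>
     (\<forall>I x. downward_cofinal I F \<and> (\<forall>T\<in>I. x T \<in> K) \<longrightarrow>
        (\<exists>a\<in>K. \<exists>J. J \<subseteq> I \<and> downward_cofinal J F \<and> loosely_converges J x a))"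

lemma loosely_compactD:
  assumes "loosely_compact K" "downward_cofinal I F" "\<And>T. T \<in> I \<Longrightarrow> x T \<in> K"
  obtains a J where "a \<in> K" "J \<subseteq> I" "downward_cofinal J F" "loosely_converges J x a"
  using assms unfolding loosely_compact_def by blast

lemma cofinal_self: "downward_cofinal F F"
  by (auto simp: downward_cofinal_def)

lemma loosely_converges_subfamily:
  assumes lim: "loosely_converges I x a" and I: "downward_cofinal I F"
    and J: "downward_cofinal J F" "J \<subseteq> I"
  shows "loosely_converges J x a"
proof -
  obtain n where n: "\<forall>S\<in>F. \<exists>i\<in>I. \<forall>j\<in>I. j \<subseteq> i \<longrightarrow> x j \<otimes> inv a \<in> set_power G (star G S) n"
    using lim unfolding loosely_converges_def by blast
  show ?thesis
    unfolding loosely_converges_def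
  proof (intro exI[of _ n] ballI)
    fix S assume "S \<in> F"
    then obtain i where i: "i \<in> I" "\<forall>j\<in>I. j \<subseteq> i \<longrightarrow> x j \<otimes> inv a \<in> set_power G (star G S) n"
      using n by blast
    then obtain j where "j \<in> J" "j \<subseteq> i" using I J(1) unfolding downward_cofinal_def by blast
    with i J(2) show "\<exists>i\<in>J. \<forall>j\<in>J. j \<subseteq> i \<longrightarrow> x j \<otimes> inv a \<in> set_power G (star G S) n"
      by (meson order_trans subsetD)
  qed
qed

text \<open>The deviation of the product is the deviation of \<open>x\<close> times the conjugate by \<open>a\<close> of the
  deviation of \<open>y\<close>; the conjugation is absorbed by replacing \<open>S\<close> with a conjugate.\<close>

lemma loosely_converges_mult:
  assumes I: "downward_cofinal I F"
    and x: "\<And>T. T \<in> I \<Longrightarrow> x T \<in> carrier G" and y: "\<And>T. T \<in> I \<Longrightarrow> y T \<in> carrier G"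
    and a: "a \<in> carrier G" and b: "b \<in> carrier G"
    and xa: "loosely_converges I x a" and yb: "loosely_converges I y b"
  shows "loosely_converges I (\<lambda>T. x T \<otimes> y T) (a \<otimes> b)"
proof -
  obtain m where m: "\<forall>S\<in>F. \<exists>i\<in>I. \<forall>j\<in>I. j \<subseteq> i \<longrightarrow> x j \<otimes> inv a \<in> set_power G (star G S) m"
    using xa unfolding loosely_converges_def by blast
  obtain n where n: "\<forall>S\<in>F. \<exists>i\<in>I. \<forall>j\<in>I. j \<subseteq> i \<longrightarrow> y j \<otimes> inv b \<in> set_power G (star G S) n"
    using yb unfolding loosely_converges_def by blast
  show ?thesis
    unfolding loosely_converges_def
  proof (intro exI[of _ "m + n"] ballI)
    fix S assume S: "S \<in> F"
    define R where "R = conjugate_set G (inv a) S"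
    have R: "R \<in> F" using F_conj S a by (simp add: R_def)
    obtain i1 where i1: "i1 \<in> I" "\<forall>j\<in>I. j \<subseteq> i1 \<longrightarrow> x j \<otimes> inv a \<in> set_power G (star G S) m"
      using m S by blast
    obtain i2 where i2: "i2 \<in> I" "\<forall>j\<in>I. j \<subseteq> i2 \<longrightarrow> y j \<otimes> inv b \<in> set_power G (star G R) n"
      using n R by blast
    have "i1 \<in> F" "i2 \<in> F" using i1 i2 I by (auto simp: downward_cofinal_def)
    then obtain k where "k \<in> F" "k \<subseteq> i1 \<inter> i2" using F_inter by blast
    then obtain i where i: "i \<in> I" "i \<subseteq> i1" "i \<subseteq> i2"
      using I unfolding downward_cofinal_def by (meson le_inf_iff order_trans)
    have "x j \<otimes> y j \<otimes> inv (a \<otimes> b) \<in> set_power G (star G S) (m + n)"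
      if j: "j \<in> I" "j \<subseteq> i" for j
    proof -
      have "(\<lambda>x. a \<otimes> x \<otimes> inv a) ` star G R \<subseteq> star G S"
        using hom_star[OF conj_hom[OF a] F_carrier[OF R]] conj_image_conjugate_inv[OF F_carrier[OF S] a]
        by (auto simp: R_def)
      moreover have "y j \<otimes> inv b \<in> set_power G (star G R) n" using i i2 j by blast
      ultimately have "a \<otimes> (y j \<otimes> inv b) \<otimes> inv a \<in> set_power G (star G S) n"
        using hom_set_power[OF conj_hom[OF a] star_carrier[OF F_carrier[OF R]]] by blast
      moreover have "x j \<otimes> inv a \<in> set_power G (star G S) m" using i i1 j by blast
      ultimately have "(x j \<otimes> inv a) \<otimes> (a \<otimes> (y j \<otimes> inv b) \<otimes> inv a)
          \<in> set_power G (star G S) (m + n)"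
        by (intro set_power_add star_carrier F_carrier S)
      then show ?thesis using x[OF j(1)] y[OF j(1)] a b
        by (simp add: m_assoc cancel_inv inv_mult_group)
    qed
    then show "\<exists>i\<in>I. \<forall>j\<in>I. j \<subseteq> i \<longrightarrow> x j \<otimes> y j \<otimes> inv (a \<otimes> b) \<in> set_power G (star G S) (m + n)"
      using i by blast
  qed
qed

lemma loosely_converges_one:
  assumes I: "downward_cofinal I F" and t: "\<And>T. T \<in> I \<Longrightarrow> t T \<in> star G T"
  shows "loosely_converges I t \<one>"
  unfolding loosely_converges_def
proof (intro exI[of _ 1] ballI)
  fix S assume S: "S \<in> F"
  then obtain i where i: "i \<in> I" "i \<subseteq> S" using I by (auto simp: downward_cofinal_def)
  have "t j \<otimes> inv \<one> \<in> set_power G (star G S) 1" if j: "j \<in> I" "j \<subseteq> i" for j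
  proof -
    have "t j \<in> star G S" using t[OF j(1)] star_mono[of j S] j i by blast
    then show ?thesis using star_carrier[OF F_carrier[OF S]] by (auto simp: set_mult_def subset_iff)
  qed
  then show "\<exists>i\<in>I. \<forall>j\<in>I. j \<subseteq> i \<longrightarrow> t j \<otimes> inv \<one> \<in> set_power G (star G S) 1" using i by blast
qed

text \<open>If each class missed the subsets of some member of \<open>F\<close>, a common lower bound of these finitely
  many members would have no index below it.\<close>

lemma cofinal_finite_partition:
  assumes I: "downward_cofinal I F" and C: "finite C" "\<And>T. T \<in> I \<Longrightarrow> f T \<in> C"
  shows "\<exists>c\<in>C. downward_cofinal {T \<in> I. f T = c} F"
proof (rule ccontr)
  assume neg: "\<not> ?thesis"
  have "\<forall>c\<in>C. \<exists>S. S \<in> F \<and> (\<forall>T\<in>I. f T = c \<longrightarrow> \<not> T \<subseteq> S)"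
  proof
    fix c assume "c \<in> C"
    then have "\<not> downward_cofinal {T \<in> I. f T = c} F" using neg by blast
    moreover have "{T \<in> I. f T = c} \<subseteq> F" using I by (auto simp: downward_cofinal_def)
    ultimately show "\<exists>S. S \<in> F \<and> (\<forall>T\<in>I. f T = c \<longrightarrow> \<not> T \<subseteq> S)"
      unfolding downward_cofinal_def by blast
  qed
  from bchoice[OF this] obtain S
    where S: "\<And>c. c \<in> C \<Longrightarrow> S c \<in> F" "\<And>c T. c \<in> C \<Longrightarrow> T \<in> I \<Longrightarrow> f T = c \<Longrightarrow> \<not> T \<subseteq> S c"
    by blast
  have "\<exists>R\<in>F. \<forall>c\<in>C. R \<subseteq> S c"
    using C(1) S(1)
  proof (induction C rule: finite_induct)
    case empty
    then show ?case using F_ne by blast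
  next
    case (insert c C)
    then obtain R where "R \<in> F" "\<forall>c\<in>C. R \<subseteq> S c" by blast
    moreover obtain R' where "R' \<in> F" "R' \<subseteq> R \<inter> S c"
      using F_inter insert.prems \<open>R \<in> F\<close> by blast
    ultimately show ?case by blast
  qed
  then obtain R where R: "R \<in> F" "\<forall>c\<in>C. R \<subseteq> S c" by blast
  then obtain T where "T \<in> I" "T \<subseteq> R" using I by (auto simp: downward_cofinal_def)
  with R S(2)[of "f T" T] C(2) show False by blast
qed

lemma loosely_compact_one: "loosely_compact {\<one>}"
  unfolding loosely_compact_def
proof (intro allI impI, elim conjE)
  fix I x assume I: "downward_cofinal I F" and x: "\<forall>T\<in>I. x T \<in> {\<one>}"
  then have "loosely_converges I x \<one>" by (intro loosely_converges_one) (auto simp: one_in_star)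
  then show "\<exists>a\<in>{\<one>}. \<exists>J. J \<subseteq> I \<and> downward_cofinal J F \<and> loosely_converges J x a"
    using I by blast
qed

lemma loosely_compact_UN:
  assumes C: "finite C" and K: "\<And>c. c \<in> C \<Longrightarrow> loosely_compact (K c)"
  shows "loosely_compact (\<Union>c\<in>C. K c)"
  unfolding loosely_compact_def
proof (intro allI impI, elim conjE)
  fix I x assume I: "downward_cofinal I F" and "\<forall>T\<in>I. x T \<in> (\<Union>c\<in>C. K c)"
  then have "\<forall>T\<in>I. \<exists>c. c \<in> C \<and> x T \<in> K c" by blast
  then obtain f where f: "\<And>T. T \<in> I \<Longrightarrow> f T \<in> C \<and> x T \<in> K (f T)" by metis
  then obtain c where c: "c \<in> C" "downward_cofinal {T \<in> I. f T = c} F"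
    using cofinal_finite_partition[OF I C, of f] by blast
  obtain a J where "a \<in> K c" "J \<subseteq> {T \<in> I. f T = c}" "downward_cofinal J F" "loosely_converges J x a"
    by (rule loosely_compactD[OF K[OF c(1)] c(2), of x]) (use f in auto)
  with c(1) show "\<exists>a\<in>\<Union> (K ` C). \<exists>J. J \<subseteq> I \<and> downward_cofinal J F \<and> loosely_converges J x a"
    by blast
qed

lemma loosely_compact_mult:
  assumes K: "loosely_compact K" "K \<subseteq> carrier G" and L: "loosely_compact L" "L \<subseteq> carrier G"
  shows "loosely_compact (K <#> L)"
  unfolding loosely_compact_def
proof (intro allI impI, elim conjE)
  fix I z assume I: "downward_cofinal I F" and "\<forall>T\<in>I. z T \<in> K <#> L"
  then have "\<forall>T\<in>I. \<exists>u v. u \<in> K \<and> v \<in> L \<and> z T = u \<otimes> v"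
    unfolding set_mult_def by blast
  then obtain u v where uv: "\<And>T. T \<in> I \<Longrightarrow> u T \<in> K \<and> v T \<in> L \<and> z T = u T \<otimes> v T"
    by metis
  obtain a J where a: "a \<in> K" "J \<subseteq> I" "downward_cofinal J F" "loosely_converges J u a"
    by (rule loosely_compactD[OF K(1) I, of u]) (use uv in auto)
  obtain b M where b: "b \<in> L" "M \<subseteq> J" "downward_cofinal M F" "loosely_converges M v b"
    by (rule loosely_compactD[OF L(1) a(3), of v]) (use uv a(2) in auto)
  have MI: "M \<subseteq> I" using a b by blast
  have "loosely_converges M (\<lambda>T. u T \<otimes> v T) (a \<otimes> b)"
    by (intro loosely_converges_mult b(3,4) loosely_converges_subfamily[OF a(4,3) b(3,2)])
      (use a(1) b(1) uv MI K(2) L(2) in auto)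
  moreover have "z T = u T \<otimes> v T" if "T \<in> M" for T using uv MI that by blast
  ultimately have "loosely_converges M z (a \<otimes> b)"
    unfolding loosely_converges_def by simp
  moreover have "a \<otimes> b \<in> K <#> L" using a(1) b(1) by (auto simp: set_mult_def)
  ultimately show "\<exists>a\<in>K <#> L. \<exists>J. J \<subseteq> I \<and> downward_cofinal J F \<and> loosely_converges J z a"
    using b(3) MI by blast
qed

end

section \<open>Self-indulgent families\<close>

locale self_indulgent_family = conjugation_closed_family +
  assumes indulgent: "self_indulgent G F"
begin

text \<open>Self-indulgence says that \<open>S\<^sup>*\<close> is compact for strong convergence, which is loose convergence
  with exponent \<open>1\<close>.\<close>

lemma loosely_compact_star:
  assumes S: "S \<in> F"
  shows "loosely_compact (star G S)"
  unfolding loosely_compact_def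
proof (intro allI impI, elim conjE)
  fix I x assume I: "downward_cofinal I F" and x: "\<forall>T\<in>I. x T \<in> star G S"
  obtain a J where a: "a \<in> star G S" and J: "downward_cofinal J I"
    and lim: "strongly_converges G F J x a"
    using indulgent S I x unfolding self_indulgent_def by blast
  have JI: "J \<subseteq> I" using J by (simp add: downward_cofinal_def)
  have JF: "downward_cofinal J F"
    unfolding downward_cofinal_def
  proof (intro conjI ballI)
    show "J \<subseteq> F" using JI I by (auto simp: downward_cofinal_def)
    fix R assume "R \<in> F"
    then obtain T where "T \<in> I" "T \<subseteq> R" using I unfolding downward_cofinal_def by blast
    moreover then obtain T' where "T' \<in> J" "T' \<subseteq> T"
      using J unfolding downward_cofinal_def by blast
    ultimately show "\<exists>T\<in>J. T \<subseteq> R" by blast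
  qed
  have "set_power G (star G R) 1 = star G R" if "R \<in> F" for R
  proof -
    have "{\<one>} <#> star G R = star G R"
      using lcos_mult_one[OF star_carrier[OF F_carrier[OF that]]]
      by (simp add: set_mult_def l_coset_def)
    then show ?thesis by simp
  qed
  then have "loosely_converges J x a"
    using lim unfolding loosely_converges_def strongly_converges_def
    by (intro exI[of _ 1]) simp
  with a JI JF show "\<exists>a\<in>star G S. \<exists>J. J \<subseteq> I \<and> downward_cofinal J F \<and> loosely_converges J x a"
    by blast
qed

lemma loosely_compact_product_over:
  assumes S: "\<And>i. S i \<subseteq> carrier G" and "finite I" "\<And>i. i \<in> I \<Longrightarrow> S i \<in> F"
  shows "loosely_compact {h. product_over G S I h}"
  using assms(2,3)
proof (induction I rule: finite_psubset_induct)
  case (psubset I)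
  show ?case
  proof (cases "I = {}")
    case True
    have "h = \<one>" if "product_over G S {} h" for h
      using that by (rule product_over.cases) simp_all
    then have "{h. product_over G S I h} = {\<one>}" using True product_over.empty[of G S] by blast
    then show ?thesis using loosely_compact_one by simp
  next
    case False
    have "loosely_compact (\<Union>i\<in>I. star G (S i) <#> {h. product_over G S (I - {i}) h})"
    proof (rule loosely_compact_UN)
      show "finite I" by (rule psubset.hyps)
    next
      fix i assume i: "i \<in> I"
      have "loosely_compact {h. product_over G S (I - {i}) h}"
        by (rule psubset.IH[of "I - {i}"]) (use i psubset.prems in blast)+
      moreover have "{h. product_over G S (I - {i}) h} \<subseteq> carrier G"
        using product_over_carrier[of S, OF S] by auto
      ultimately show "loosely_compact (star G (S i) <#> {h. product_over G S (I - {i}) h})"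
        using loosely_compact_mult[OF loosely_compact_star[OF psubset.prems[OF i]]
            star_carrier[OF S]] by simp
    qed
    then show ?thesis by (simp only: product_over_Diff_eq[of S, OF S False])
  qed
qed

end

locale separated_family = self_indulgent_family +
  assumes separated: "g \<in> carrier G \<Longrightarrow> g \<noteq> \<one> \<Longrightarrow> n > 0 \<Longrightarrow> \<exists>S\<in>F. g \<notin> set_power G (star G S) n"
begin

text \<open>The separation hypothesis gives uniqueness of loose limits, used here for constant
  families. The exponent is raised by one because separation speaks of positive exponents.\<close>

lemma loose_limit_of_constant:
  assumes I: "downward_cofinal I F" and lim: "loosely_converges I x a"
    and x: "\<And>T. T \<in> I \<Longrightarrow> x T = g" and g: "g \<in> carrier G" and a: "a \<in> carrier G"
  shows "g = a"
proof -
  obtain n where n: "\<forall>S\<in>F. \<exists>i\<in>I. \<forall>j\<in>I. j \<subseteq> i \<longrightarrow> x j \<otimes> inv a \<in> set_power G (star G S) n"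
    using lim unfolding loosely_converges_def by blast
  have "g \<otimes> inv a \<in> set_power G (star G S) (n + 1)" if S: "S \<in> F" for S
  proof -
    obtain i where i: "i \<in> I" "\<forall>j\<in>I. j \<subseteq> i \<longrightarrow> x j \<otimes> inv a \<in> set_power G (star G S) n"
      using n S by blast
    then have "x i \<otimes> inv a \<in> set_power G (star G S) n" by blast
    then have "g \<otimes> inv a \<in> set_power G (star G S) n" using x i(1) by simp
    then have "(g \<otimes> inv a) \<otimes> \<one> \<in> set_power G (star G S) (n + 1)"
      by (intro set_power_add star_carrier F_carrier S one_in_set_power one_in_star)
    then show ?thesis using g a by simp
  qed
  then have "g \<otimes> inv a = \<one>" using separated[of "g \<otimes> inv a" "n + 1"] g a by auto
  then have "g \<otimes> inv a \<otimes> a = a" using a by simp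
  then show ?thesis using g a by (simp add: m_assoc)
qed

text \<open>If every \<open>T\<close> failed, the resulting factorisations \<open>g = a\<^sub>T t\<^sub>T b\<^sub>T\<close> would converge along a cofinal
  subfamily to a factorisation of \<open>g\<close> with middle factor \<open>\<one>\<close>, which only uses indices in \<open>I\<close>.\<close>

lemma avoid_extension:
  assumes S: "\<And>i. S i \<subseteq> carrier G" and I: "finite I" "\<And>i. i \<in> I \<Longrightarrow> S i \<in> F" "k \<notin> I"
    and g: "g \<in> carrier G" and avoid: "\<not> product_over G S I g"
  shows "\<exists>T\<in>F. \<not> product_over G (S(k := T)) (insert k I) g"
proof (rule ccontr)
  assume neg: "\<not> ?thesis"
  have "\<exists>J K a t b. J \<subseteq> I \<and> K \<subseteq> I \<and> J \<inter> K = {} \<and> product_over G S J a \<and>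
     t \<in> star G T \<and> product_over G S K b \<and> g = a \<otimes> t \<otimes> b" if T: "T \<in> F" for T
  proof -
    let ?S = "S(k := T)"
    have Sc: "?S i \<subseteq> carrier G" for i using S F_carrier[OF T] by simp
    have p: "product_over G ?S (insert k I) g" using neg T by blast
    obtain J K a t b where *: "J \<subseteq> insert k I - {k}" "K \<subseteq> insert k I - {k}" "J \<inter> K = {}"
      "product_over G ?S J a" "t \<in> star G (?S k)" "product_over G ?S K b" "g = a \<otimes> t \<otimes> b"
      using product_over_split[of ?S, OF Sc p insertI1] by (elim exE conjE)
    have "product_over G S J a" by (rule product_over_cong[OF *(4)]) (use *(1) in auto)
    moreover have "product_over G S K b" by (rule product_over_cong[OF *(6)]) (use *(2) in auto)
    moreover have "J \<subseteq> I" "K \<subseteq> I" "t \<in> star G T" using * by auto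
    ultimately show ?thesis using *(3,7)
      by - (rule exI[of _ J], rule exI[of _ K], rule exI[of _ a], rule exI[of _ t],
          rule exI[of _ b], intro conjI)
  qed
  then have "\<forall>T\<in>F. \<exists>p. case p of (J, K, a, t, b) \<Rightarrow> J \<subseteq> I \<and> K \<subseteq> I \<and> J \<inter> K = {} \<and>
     product_over G S J a \<and> t \<in> star G T \<and> product_over G S K b \<and> g = a \<otimes> t \<otimes> b"
    by simp
  from bchoice[OF this] obtain p
    where p: "\<forall>T\<in>F. case p T of (J, K, a, t, b) \<Rightarrow> J \<subseteq> I \<and> K \<subseteq> I \<and> J \<inter> K = {} \<and>
      product_over G S J a \<and> t \<in> star G T \<and> product_over G S K b \<and> g = a \<otimes> t \<otimes> b" ..
  define J where "J T = fst (p T)" for T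
  define K where "K T = fst (snd (p T))" for T
  define a where "a T = fst (snd (snd (p T)))" for T
  define t where "t T = fst (snd (snd (snd (p T))))" for T
  define b where "b T = snd (snd (snd (snd (p T))))" for T
  have q: "J T \<subseteq> I" "K T \<subseteq> I" "J T \<inter> K T = {}" "product_over G S (J T) (a T)"
    "t T \<in> star G T" "product_over G S (K T) (b T)" "g = a T \<otimes> t T \<otimes> b T" if "T \<in> F" for T
    using bspec[OF p that]
    by (auto simp: J_def K_def a_def t_def b_def split: prod.splits)
  \<comment> \<open>Only finitely many pairs of index sets occur, so one pair occurs cofinally.\<close>
  obtain J0 K0 where JK: "downward_cofinal {T \<in> F. (J T, K T) = (J0, K0)} F"
  proof -
    have "finite (Pow I \<times> Pow I)" using I(1) by simp
    from cofinal_finite_partition[OF cofinal_self this, of "\<lambda>T. (J T, K T)"] q(1,2)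
    obtain c where "downward_cofinal {T \<in> F. (J T, K T) = c} F" by auto
    then show thesis using that by (cases c) simp
  qed
  let ?I0 = "{T \<in> F. (J T, K T) = (J0, K0)}"
  have cJ: "loosely_compact {h. product_over G S J' h}" if "J' \<subseteq> I" for J'
    by (rule loosely_compact_product_over[of S, OF S])
      (use that I finite_subset in auto)
  have "?I0 \<noteq> {}" using JK F_ne by (auto simp: downward_cofinal_def)
  then obtain T0 where "T0 \<in> F" "J T0 = J0" "K T0 = K0" by auto
  then have JK0: "J0 \<subseteq> I" "K0 \<subseteq> I" "J0 \<inter> K0 = {}" using q(1-3)[of T0] by auto
  obtain a0 I1 where a0: "a0 \<in> {h. product_over G S J0 h}" "I1 \<subseteq> ?I0" "downward_cofinal I1 F"
    "loosely_converges I1 a a0"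
    by (rule loosely_compactD[OF cJ[OF JK0(1)] JK, of a]) (use q(4) in auto)
  have "b T \<in> {h. product_over G S K0 h}" if "T \<in> I1" for T using q(6)[of T] a0(2) that by auto
  then obtain b0 I2 where b0: "b0 \<in> {h. product_over G S K0 h}" "I2 \<subseteq> I1"
    "downward_cofinal I2 F" "loosely_converges I2 b b0"
    by (rule loosely_compactD[OF cJ[OF JK0(2)] a0(3), of b])
  have I2F: "T \<in> F" if "T \<in> I2" for T using that b0(2) a0(2) by auto
  have c: "a T \<in> carrier G" "t T \<in> carrier G" "b T \<in> carrier G" if "T \<in> I2" for T
    using product_over_carrier[of S, OF S q(4)] product_over_carrier[of S, OF S q(6)]
      subsetD[OF star_carrier[OF F_carrier] q(5)] I2F[OF that] by auto
  have a0c: "a0 \<in> carrier G" and b0c: "b0 \<in> carrier G"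
    using product_over_carrier[of S, OF S] a0(1) b0(1) by auto
  have "loosely_converges I2 t \<one>" by (rule loosely_converges_one[OF b0(3)]) (use q(5) I2F in auto)
  then have "loosely_converges I2 (\<lambda>T. a T \<otimes> t T \<otimes> b T) (a0 \<otimes> \<one> \<otimes> b0)"
    by (intro loosely_converges_mult b0(3,4) loosely_converges_subfamily[OF a0(4,3) b0(3,2)])
      (use c a0c b0c in auto)
  then have "g = a0 \<otimes> \<one> \<otimes> b0"
    by (rule loose_limit_of_constant[OF b0(3)]) (use q(7) I2F g a0c b0c in auto)
  then have "product_over G S (J0 \<union> K0) g"
    using product_over_append[of S, OF S _ _ JK0(3)] a0 b0 a0c by simp
  then have "product_over G S I g"
    by (rule product_over_mono[of S, OF S]) (use JK0 I in auto)
  then show False using avoid by simp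
qed

text \<open>The sequence arises by dependent choice from \<open>avoid_extension\<close>. Every finite index set lies
  in an initial segment of the natural numbers, so avoiding \<open>g\<close> at each stage is enough.\<close>

lemma exists_product_nbhd_avoiding:
  assumes g: "g \<in> carrier G" "g \<noteq> \<one>"
  shows "\<exists>S. range S \<subseteq> F \<and> g \<notin> product_nbhd G S"
proof -
  define P where "P f m T \<longleftrightarrow> T \<in> F \<and> \<not> product_over G (f(m := T)) (insert m {..<m}) g"
    for f :: "nat \<Rightarrow> 'a set" and m T
  have "\<exists>f. \<forall>m. P f m (f m)"
  proof (rule dependent_wellorder_choice)
    fix T :: "'a set" and f f' :: "nat \<Rightarrow> 'a set" and m :: nat
    assume eq: "\<And>k. k < m \<Longrightarrow> f k = f' k"
    have "product_over G (f(m := T)) (insert m {..<m}) g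
      \<longleftrightarrow> product_over G (f'(m := T)) (insert m {..<m}) g"
      by (rule iffI; erule product_over_cong) (auto simp: eq)
    then show "P f m T = P f' m T" by (simp add: P_def)
  next
    fix m :: nat and f :: "nat \<Rightarrow> 'a set"
    assume IH: "\<And>k. k < m \<Longrightarrow> P f k (f k)"
    \<comment> \<open>Terms that have not been chosen yet are arbitrary; emptying them keeps all terms in the carrier.\<close>
    define S where "S k = (if k < m then f k else {})" for k
    have fF: "f k \<in> F" if "k < m" for k using IH[OF that] by (simp add: P_def)
    have Sc: "S k \<subseteq> carrier G" for k using F_carrier[OF fF] by (simp add: S_def)
    have "\<not> product_over G f {..<m} g"
    proof (cases m)
      case 0
      have "\<not> product_over G f {} g"
      proof
        assume "product_over G f {} g"
        then show False by cases (use g in auto)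
      qed
      then show ?thesis by (simp add: 0)
    next
      case (Suc k)
      then have "\<not> product_over G (f(k := f k)) (insert k {..<k}) g" using IH[of k] by (simp add: P_def)
      then show ?thesis by (simp add: Suc lessThan_Suc)
    qed
    then have avoid: "\<not> product_over G S {..<m} g"
      using product_over_cong[of G S "{..<m}" g f] by (auto simp: S_def)
    obtain T where T: "T \<in> F" "\<not> product_over G (S(m := T)) (insert m {..<m}) g"
      using avoid_extension[of S, OF Sc _ _ _ g(1) avoid, of m] fF by (auto simp: S_def)
    have "(f(m := T)) i = (S(m := T)) i" if "i \<in> insert m {..<m}" for i
      using that by (auto simp: S_def)
    with T(2) have "\<not> product_over G (f(m := T)) (insert m {..<m}) g"
      using product_over_cong[of G "f(m := T)" "insert m {..<m}" g "S(m := T)"] by blast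
    with T(1) have "P f m T" by (simp add: P_def)
    then show "\<exists>T. P f m T" ..
  qed
  then obtain S where S: "\<And>m. P S m (S m)" by blast
  have SF: "S m \<in> F" for m using S by (simp add: P_def)
  have "\<not> product_over G S I g" for I
  proof
    assume I: "product_over G S I g"
    obtain m where m: "\<forall>i\<in>I. i < m"
      using product_over_finite[OF I] unfolding finite_nat_set_iff_bounded ..
    have "product_over G S (insert m {..<m}) g"
      by (rule product_over_mono[of S, OF F_carrier[OF SF] I]) (use m in auto)
    then show False using S[of m] by (simp add: P_def)
  qed
  then have "g \<notin> product_nbhd G S" by (simp add: product_nbhd_def)
  then show ?thesis using SF by blast
qed

end

section \<open>Hausdorff group topologies force separation\<close>

context group
begin

text \<open>Continuity of multiplication at \<open>(\<one>, \<one>)\<close> splits off one factor at a time; intersecting with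
  the preimage under inversion turns a neighbourhood \<open>V\<close> into one whose \<open>V\<^sup>*\<close> is under control.\<close>

lemma group_topology_power_nbhd:
  assumes T: "group_topology G T" and U: "openin T U" "\<one> \<in> U"
  shows "\<exists>V. openin T V \<and> \<one> \<in> V \<and> set_power G (star G V) n \<subseteq> U"
  using U
proof (induction n arbitrary: U)
  case 0
  then show ?case by auto
next
  case (Suc n)
  have top: "topspace T = carrier G" using T by (simp add: group_topology_def)
  let ?M = "{p \<in> topspace (prod_topology T T). (case p of (x, y) \<Rightarrow> x \<otimes> y) \<in> U}"
  have "openin (prod_topology T T) ?M"
    using T Suc.prems(1) unfolding group_topology_def continuous_map_def by blast
  moreover have "(\<one>, \<one>) \<in> ?M" using Suc.prems(2) by (simp add: top)
  ultimately obtain P Q where P: "openin T P" "\<one> \<in> P" and Q: "openin T Q" "\<one> \<in> Q"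
    and PQ: "P \<times> Q \<subseteq> ?M"
    unfolding openin_prod_topology_alt by meson
  obtain V where V: "openin T V" "\<one> \<in> V" "set_power G (star G V) n \<subseteq> P"
    using Suc.IH[OF P] by blast
  define Q' where "Q' = {x \<in> topspace T. inv x \<in> Q}"
  have Q': "openin T Q'"
    using T Q(1) unfolding group_topology_def continuous_map_def Q'_def by blast
  have "\<one> \<in> Q'" using Q(2) by (simp add: Q'_def top)
  define W where "W = V \<inter> (Q \<inter> Q')"
  have "openin T W" using V(1) Q(1) Q' by (simp add: W_def openin_Int)
  moreover have "\<one> \<in> W" using V(2) Q(2) \<open>\<one> \<in> Q'\<close> by (simp add: W_def)
  moreover have "set_power G (star G W) (Suc n) \<subseteq> U"
  proof
    fix z assume "z \<in> set_power G (star G W) (Suc n)"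
    then obtain u w where z: "z = u \<otimes> w" "u \<in> set_power G (star G W) n" "w \<in> star G W"
      by (auto simp: set_mult_def)
    have "W \<subseteq> V" by (auto simp: W_def)
    then have "u \<in> P" using z(2) set_power_mono[OF star_mono[of W V], of n] V(3) by blast
    moreover have "w \<in> Q" using z(3) Q(2) by (auto simp: star_def SET_INV_def W_def Q'_def)
    ultimately show "z \<in> U" using PQ z(1) by auto
  qed
  ultimately show ?case by blast
qed

lemma separated_of_Hausdorff:
  assumes T: "group_topology G T" and F: "family_converges T F \<one>" and H: "Hausdorff_space T"
    and g: "g \<in> carrier G" "g \<noteq> \<one>"
  shows "\<exists>S\<in>F. g \<notin> set_power G (star G S) n"
proof -
  have "topspace T = carrier G" using T by (simp add: group_topology_def)
  then obtain U V where U: "openin T U" "\<one> \<in> U" "g \<in> V" "disjnt U V"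
    using H g unfolding Hausdorff_space_def by (metis one_closed)
  then have gU: "g \<notin> U" by (auto simp: disjnt_def)
  obtain W where W: "openin T W" "\<one> \<in> W" "set_power G (star G W) n \<subseteq> U"
    using group_topology_power_nbhd[OF T U(1,2)] by blast
  obtain S where S: "S \<in> F" "S \<subseteq> W" using F W(1,2) unfolding family_converges_def by blast
  have "set_power G (star G S) n \<subseteq> U"
    using set_power_mono[OF star_mono[OF S(2)], of n] W(3) by blast
  with gU S(1) show ?thesis by blast
qed

lemma Hausdorff_finest_iff:
  assumes F: "downward_directed G F" "self_indulgent G F" "conjugation_closed G F"
  shows "Hausdorff_space (finest_group_topology G F) \<longleftrightarrow>
    (\<forall>g\<in>carrier G - {\<one>}. \<forall>n>0. \<exists>S\<in>F. g \<notin> set_power G (star G S) n)" (is "?H \<longleftrightarrow> ?sep")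
proof
  interpret conjugation_closed_family G F
    by unfold_locales (rule F)+
  show ?sep if ?H
  proof (intro ballI allI impI)
    fix g n assume "g \<in> carrier G - {\<one>}"
    then show "\<exists>S\<in>F. g \<notin> set_power G (star G S) n"
      using separated_of_Hausdorff[OF _ _ that, of F g n] finest
      by (simp add: is_finest_group_topology_def)
  qed
  show ?H if sep: ?sep
  proof -
    interpret separated_family G F
      by unfold_locales (use F(2) sep in auto)
    show ?H by (rule Hausdorff_finest) (rule exists_product_nbhd_avoiding)
  qed
qed

lemma union_of_intersections_trivial_iff:
  assumes F: "downward_directed G F"
  shows "(\<Union>n\<in>{0<..}. \<Inter>S\<in>F. set_power G (star G S) n) = {\<one>} \<longleftrightarrow>
    (\<forall>g\<in>carrier G - {\<one>}. \<forall>n>0. \<exists>S\<in>F. g \<notin> set_power G (star G S) n)"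
proof -
  define P where "P n = (\<Inter>S\<in>F. set_power G (star G S) n)" for n
  have one: "\<one> \<in> P n" for n
    unfolding P_def by (intro INT_I one_in_set_power one_in_star)
  have "F \<noteq> {}" and "F \<subseteq> Pow (carrier G)" using F by (simp_all add: downward_directed_def)
  then obtain S0 where S0: "S0 \<in> F" "S0 \<subseteq> carrier G" by blast
  have "P n \<subseteq> set_power G (star G S0) n" for n unfolding P_def by (rule INT_lower[OF S0(1)])
  then have P: "P n \<subseteq> carrier G" for n
    using set_power_carrier[OF star_carrier[OF S0(2)], of n] by (rule order_trans)
  have "\<one> \<in> (\<Union>n\<in>{0<..}. P n)" using one[of 1] by (intro UN_I[of 1]) simp_all
  then have "(\<Union>n\<in>{0<..}. P n) = {\<one>} \<longleftrightarrow> (\<forall>n\<in>{0<..}. P n \<subseteq> {\<one>})"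
    by (simp only: set_eq_subset UN_subset_iff insert_subset empty_subsetI simp_thms)
  also have "\<dots> \<longleftrightarrow> (\<forall>g\<in>carrier G - {\<one>}. \<forall>n>0. g \<notin> P n)"
  proof (intro iffI ballI allI impI subsetI)
    fix g and n :: nat
    assume "\<forall>n\<in>{0<..}. P n \<subseteq> {\<one>}" "g \<in> carrier G - {\<one>}" "n > 0"
    then have "P n \<subseteq> {\<one>}" "g \<noteq> \<one>" by simp_all
    then show "g \<notin> P n" by blast
  next
    fix g and n :: nat
    assume *: "\<forall>g\<in>carrier G - {\<one>}. \<forall>n>0. g \<notin> P n" "n \<in> {0<..}" and g: "g \<in> P n"
    have "g \<in> carrier G" using P g by (rule subsetD)
    then show "g \<in> {\<one>}" using * g by blast
  qed
  also have "\<dots> \<longleftrightarrow> (\<forall>g\<in>carrier G - {\<one>}. \<forall>n>0. \<exists>S\<in>F. g \<notin> set_power G (star G S) n)"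
    by (simp only: P_def INT_iff Set.ball_simps)
  finally show ?thesis unfolding P_def .
qed

end

section \<open>Complements of small subsets\<close>

lemma co_filterI: "A \<subseteq> X \<Longrightarrow> |A| <o \<kappa> \<Longrightarrow> X - A \<in> co_filter X \<kappa>"
  by (auto simp: co_filter_def)

lemma co_filterE:
  assumes "S \<in> co_filter X \<kappa>"
  obtains A where "A \<subseteq> X" "|A| <o \<kappa>" "S = X - A"
  using assms by (auto simp: co_filter_def)

context group
begin

lemma downward_directed_co_filter:
  assumes X: "X \<subseteq> carrier G" and \<kappa>: "Cinfinite \<kappa>"
  shows "downward_directed G (co_filter X \<kappa>)"
  unfolding downward_directed_def
proof (intro conjI ballI)
  show "co_filter X \<kappa> \<subseteq> Pow (carrier G)" using X by (auto simp: co_filter_def)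
  have "|{} :: 'a set| <o \<kappa>"
    using \<kappa> card_of_Card_order[of "{} :: 'a set"]
    by (intro Cfinite_ordLess_Cinfinite) (simp_all add: cfinite_def Field_card_of)
  then show "co_filter X \<kappa> \<noteq> {}" using co_filterI[of "{}" X \<kappa>] by auto
  fix S T assume "S \<in> co_filter X \<kappa>" "T \<in> co_filter X \<kappa>"
  then obtain A B where A: "A \<subseteq> X" "|A| <o \<kappa>" "S = X - A" and B: "B \<subseteq> X" "|B| <o \<kappa>" "T = X - B"
    by (elim co_filterE)
  have "|A \<union> B| <o \<kappa>" by (rule Un_Cinfinite_bound_strict[OF A(2) B(2) \<kappa>])
  then have "X - (A \<union> B) \<in> co_filter X \<kappa>" using A(1) B(1) by (intro co_filterI) simp_all
  moreover have "X - (A \<union> B) \<subseteq> S \<inter> T" using A(3) B(3) by blast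
  ultimately show "\<exists>R\<in>co_filter X \<kappa>. R \<subseteq> S \<inter> T" by (rule bexI[rotated])
qed

lemma conjugation_closed_co_filter:
  assumes X: "X \<subseteq> carrier G" and inv: "\<forall>g\<in>carrier G. conjugate_set G g X = X"
  shows "conjugation_closed G (co_filter X \<kappa>)"
  unfolding conjugation_closed_def
proof (intro ballI)
  fix S g assume "S \<in> co_filter X \<kappa>" and g: "g \<in> carrier G"
  then obtain A where A: "A \<subseteq> X" "|A| <o \<kappa>" "S = X - A" by (elim co_filterE)
  let ?c = "\<lambda>x. g \<otimes> x \<otimes> inv g"
  have cX: "?c ` X = X" using inv g by (simp add: conjugate_set_eq)
  have "inj_on ?c X" using subsetD[OF X] g by (intro inj_onI) simp
  then have "?c ` S = X - ?c ` A" using A cX by (simp add: inj_on_image_set_diff)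
  moreover have "?c ` A \<subseteq> X" using A(1) cX by blast
  moreover have "|?c ` A| <o \<kappa>" using card_of_image A(2) by (rule ordLeq_ordLess_trans)
  ultimately show "conjugate_set G g S \<in> co_filter X \<kappa>"
    by (simp add: conjugate_set_eq co_filterI)
qed

text \<open>Either some value occurs cofinally and is the limit, or each value \<open>c\<close> is avoided below some
  \<open>X - E c\<close> with \<open>E c\<close> small. In the second case the limit is \<open>\<one>\<close>: membership in
  \<open>(X - A)\<^sup>*\<close> can only fail at the few values in \<open>A\<close> or its inverse, and the union of the
  corresponding sets \<open>E c\<close> is small because \<open>\<kappa>\<close> is regular.\<close>

lemma self_indulgent_co_filter:
  assumes X: "X \<subseteq> carrier G" and \<kappa>: "Cinfinite \<kappa>" "regularCard \<kappa>"
  shows "self_indulgent G (co_filter X \<kappa>)"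
  unfolding self_indulgent_def
proof (intro ballI allI impI, elim conjE)
  fix S F' and x :: "'a set \<Rightarrow> 'a"
  assume S: "S \<in> co_filter X \<kappa>" and F': "downward_cofinal F' (co_filter X \<kappa>)"
    and x: "\<forall>T\<in>F'. x T \<in> star G S"
  have F'F: "F' \<subseteq> co_filter X \<kappa>" and below: "\<And>R. R \<in> co_filter X \<kappa> \<Longrightarrow> \<exists>T\<in>F'. T \<subseteq> R"
    using F' by (auto simp: downward_cofinal_def)
  have SX: "S \<subseteq> X" using S by (auto simp: co_filter_def)
  have Sc: "star G S \<subseteq> carrier G" using SX X by (intro star_carrier) auto
  show "\<exists>a\<in>star G S. \<exists>F''. downward_cofinal F'' F' \<and> strongly_converges G (co_filter X \<kappa>) F'' x a"
  proof (cases "\<exists>c. downward_cofinal {T \<in> F'. x T = c} F'")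
    case True
    then obtain c where c: "downward_cofinal {T \<in> F'. x T = c} F'" ..
    obtain T where T: "T \<in> F'" "x T = c"
      using c below[OF S] unfolding downward_cofinal_def by blast
    then have cS: "c \<in> star G S" using x by blast
    then have "c \<otimes> inv c = \<one>" using Sc by auto
    then have "strongly_converges G (co_filter X \<kappa>) {T \<in> F'. x T = c} x c"
      unfolding strongly_converges_def using T one_in_star by auto
    with c cS show ?thesis by blast
  next
    case False
    have "\<exists>A. A \<subseteq> X \<and> |A| <o \<kappa> \<and> (\<forall>T\<in>F'. x T = c \<longrightarrow> \<not> T \<subseteq> X - A)" for c
    proof -
      have "\<not> downward_cofinal {T \<in> F'. x T = c} F'" using False by blast
      then obtain R where R: "R \<in> F'" "\<forall>T\<in>F'. x T = c \<longrightarrow> \<not> T \<subseteq> R"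
        unfolding downward_cofinal_def by blast
      then obtain A where "A \<subseteq> X" "|A| <o \<kappa>" "R = X - A" using F'F by (blast elim: co_filterE)
      with R(2) show ?thesis by blast
    qed
    then obtain E where E: "\<And>c. E c \<subseteq> X" "\<And>c. |E c| <o \<kappa>"
      "\<And>c T. T \<in> F' \<Longrightarrow> x T = c \<Longrightarrow> \<not> T \<subseteq> X - E c"
      by metis
    have "strongly_converges G (co_filter X \<kappa>) F' x \<one>"
      unfolding strongly_converges_def
    proof
      fix R assume "R \<in> co_filter X \<kappa>"
      then obtain A where A: "A \<subseteq> X" "|A| <o \<kappa>" "R = X - A" by (elim co_filterE)
      define D where "D = A \<union> (\<lambda>a. inv a) ` A"
      have "|(\<lambda>a. inv a) ` A| <o \<kappa>" using card_of_image A(2) by (rule ordLeq_ordLess_trans)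
      then have "|D| <o \<kappa>" unfolding D_def by (intro Un_Cinfinite_bound_strict A(2) \<kappa>(1))
      then have "|\<Union>c\<in>D. E c| <o \<kappa>" using E(2)
        by (intro card_of_UNION_ordLess_infinite_Field_regularCard \<kappa>) auto
      then have "X - (\<Union>c\<in>D. E c) \<in> co_filter X \<kappa>" using E(1) by (intro co_filterI) auto
      then obtain i where i: "i \<in> F'" "i \<subseteq> X - (\<Union>c\<in>D. E c)" using below by blast
      have "x j \<otimes> inv \<one> \<in> star G R" if j: "j \<in> F'" "j \<subseteq> i" for j
      proof -
        have "x j \<notin> D" using E(3)[OF j(1) refl] j(2) i(2) by blast
        moreover have xS: "x j \<in> star G S" using x j(1) by blast
        ultimately have "x j \<in> star G R"
          using SX by (auto simp: star_def SET_INV_def D_def A(3))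
        moreover have "x j \<in> carrier G" using xS Sc by blast
        ultimately show ?thesis by simp
      qed
      then show "\<exists>i\<in>F'. \<forall>j\<in>F'. j \<subseteq> i \<longrightarrow> x j \<otimes> inv \<one> \<in> star G R" using i(1) by blast
    qed
    moreover have "downward_cofinal F' F'" by (auto simp: downward_cofinal_def)
    ultimately show ?thesis using one_in_star by blast
  qed
qed

end

theorem theorem20:
  fixes G :: "('a, 'm) monoid_scheme"
  assumes "group G"
  shows
    "(\<forall>F. downward_directed G F \<and> self_indulgent G F \<and> conjugation_closed G F \<longrightarrow>
        (Hausdorff_space (finest_group_topology G F) \<longleftrightarrow>
           (\<Union>n\<in>{0<..}. \<Inter>S\<in>F. set_power G (star G S) n) = {\<one>\<^bsub>G\<^esub>}) \<and>
        (Hausdorff_space (finest_group_topology G F) \<longleftrightarrow>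
           (\<forall>g\<in>carrier G - {\<one>\<^bsub>G\<^esub>}. \<forall>n>0. \<exists>S\<in>F. g \<notin> set_power G (star G S) n))) \<and>
     (\<forall>X (\<kappa> :: 'k rel).
        X \<subseteq> carrier G \<and> infinite X \<and> (\<forall>g\<in>carrier G. conjugate_set G g X = X) \<and>
        Cinfinite \<kappa> \<and> regularCard \<kappa> \<and> \<kappa> \<le>o |X| \<longrightarrow>
        downward_directed G (co_filter X \<kappa>) \<and>
        self_indulgent G (co_filter X \<kappa>) \<and>
        conjugation_closed G (co_filter X \<kappa>))"
proof (intro conjI allI impI; elim conjE)
  interpret group G by fact
  fix F assume F: "downward_directed G F" "self_indulgent G F" "conjugation_closed G F"
  show "Hausdorff_space (finest_group_topology G F) \<longleftrightarrow>
      (\<forall>g\<in>carrier G - {\<one>\<^bsub>G\<^esub>}. \<forall>n>0. \<exists>S\<in>F. g \<notin> set_power G (star G S) n)"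
    by (rule Hausdorff_finest_iff[OF F])
  then show "Hausdorff_space (finest_group_topology G F) \<longleftrightarrow>
      (\<Union>n\<in>{0<..}. \<Inter>S\<in>F. set_power G (star G S) n) = {\<one>\<^bsub>G\<^esub>}"
    using union_of_intersections_trivial_iff[OF F(1)] by simp
next
  interpret group G by fact
  fix X and \<kappa> :: "'k rel"
  assume X: "X \<subseteq> carrier G" "\<forall>g\<in>carrier G. conjugate_set G g X = X"
    and "cinfinite \<kappa>" "Card_order \<kappa>" and regular: "regularCard \<kappa>"
  then have \<kappa>: "Cinfinite \<kappa>" by simp
  show "downward_directed G (co_filter X \<kappa>)"
    by (rule downward_directed_co_filter[OF X(1) \<kappa>])
  show "self_indulgent G (co_filter X \<kappa>)"
    by (rule self_indulgent_co_filter[OF X(1) \<kappa> regular])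
  show "conjugation_closed G (co_filter X \<kappa>)"
    by (rule conjugation_closed_co_filter[OF X])
qed

end
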